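(* Let $\kappa$ be a regular uncountable cardinal. Player I does not have a winning strategy in the game $G_{\mathrm{Filter}}(\kappa,\kappa^+)$ if and only if there are stationarily many internally approachable $\kappa$-suitable models $M\subseteq H(\kappa^+)$ such that there is a $\kappa$-amenable, $\kappa$-complete $M$-ultrafilter on $\kappa$.
   Context: A $\kappa$-suitable model is a transitive set $M\subseteq H(\kappa^+)$ satisfying ZFC$^-$ and closed under ${<}\kappa$-sequences. An $M$-ultrafilter on $\kappa$ is an ultrafilter on $P(\kappa)\cap M$; it is $\kappa$-complete if intersections of fewer than $\kappa$ of its members are nonempty; it is $\kappa$-amenable if for every $\mathcal A\subseteq P(\kappa)\cap M$ with $\mathcal A\in M$ and $|\mathcal A|^M\le\kappa$, $U\cap\mathcal A\in M$. $M$ is internally approachable if $M=\bigcup_{\alpha<\kappa^+}N_\alpha$ for a sequence of $\kappa$-suitable models $N_\alpha$ with $\langle N_\alpha:\alpha<\beta\rangle\in N_\beta$ for all $\beta<\kappa^+$. "Stationarily many" means: for every $F:[H(\kappa^+)]^{<\omega}\to H(\kappa^+)$ there is such an $M$ closed under $F$. The game $G_{\mathrm{Filter}}(\kappa,\kappa^+)$: at each stage $i<\kappa^+$, Player I plays a $\kappa$-suitable model $M_i$ of cardinality at most $\max(\kappa,|i|)$ containing $\bigcup_{j<i}M_j$; Player II responds with a $\kappa$-complete uniform filter $F_i$ on $\kappa$ extending $\bigcup_{j<i}F_j$ such that $F_i\cap M_i$ is a $\kappa$-complete $M_i$-ultrafilter. Player I wins iff at some stage Player II has no legal move.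
   Formalization: κ^{<κ}=κ is assumed (otherwise I has no legal move and no internally approachable M exists); κ-suitable models must contain κ (otherwise H(κ) is a winning first move for I); the M-ultrafilter on the right must be uniform (otherwise principal ones always satisfy it). *)

theory Defs
  imports Main "HOL-Library.FuncSet" "HOL-Library.Equipollence" "HOL-Library.Countable_Set"
begin

text \<open>
  The ambient universe of sets. The axioms are second order, so that no set of cardinality
  at most that of a given \<open>x\<close> is missing. Every model of second-order ZFC is an instance, and
  so is the structure \<open>H(\<kappa>\<^sup>+)\<close> itself, for each infinite \<open>\<kappa>\<close>; neither the power set axiom
  nor the existence of \<open>\<kappa>\<^sup>+\<close> as an element of the universe is needed.
\<close>

class set_universe =
  fixes elts :: "'a \<Rightarrow> 'a set"
  assumes extensionality: "elts x = elts y \<Longrightarrow> x = y"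
    and foundation: "wf {(x, y). x \<in> elts y}"
    and replacement: "X \<lesssim> elts x \<Longrightarrow> X \<in> range elts"


section \<open>Pairs, functions, ordinals, cardinals\<close>

definition vset :: "'v::set_universe set \<Rightarrow> 'v" where
  "vset X = (THE x. elts x = X)"

definition vpair :: "'v::set_universe \<Rightarrow> 'v \<Rightarrow> 'v" where
  "vpair x y = vset {vset {x}, vset {x, y}}"

text \<open>The function \<open>f\<close> restricted to the set \<open>d\<close>, as a set of the universe.\<close>

definition fun_graph :: "'v::set_universe \<Rightarrow> ('v \<Rightarrow> 'v) \<Rightarrow> 'v" where
  "fun_graph d f = vset ((\<lambda>x. vpair x (f x)) ` elts d)"

definition transitive_set :: "'v::set_universe set \<Rightarrow> bool" where
  "transitive_set A \<longleftrightarrow> (\<forall>x\<in>A. elts x \<subseteq> A)"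

definition Ord :: "'v::set_universe \<Rightarrow> bool" where
  "Ord \<alpha> \<longleftrightarrow> transitive_set (elts \<alpha>) \<and> (\<forall>x\<in>elts \<alpha>. transitive_set (elts x))"

definition Card :: "'v::set_universe \<Rightarrow> bool" where
  "Card \<kappa> \<longleftrightarrow> Ord \<kappa> \<and> (\<forall>\<alpha>\<in>elts \<kappa>. elts \<alpha> \<prec> elts \<kappa>)"

definition regular_cardinal :: "'v::set_universe \<Rightarrow> bool" where
  "regular_cardinal \<kappa> \<longleftrightarrow> Card \<kappa> \<and> infinite (elts \<kappa>) \<and>
     (\<forall>X\<subseteq>elts \<kappa>. X \<prec> elts \<kappa> \<longrightarrow> (\<exists>\<beta>\<in>elts \<kappa>. X \<subseteq> elts \<beta>))"

text \<open>The cardinal \<open>\<kappa>\<^sup>+\<close>, as the collection of the ordinals below it.\<close>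

definition succ_card :: "'v::set_universe \<Rightarrow> 'v set" where
  "succ_card \<kappa> = {\<alpha>. Ord \<alpha> \<and> elts \<alpha> \<lesssim> elts \<kappa>}"

definition trans_closure :: "'v::set_universe \<Rightarrow> 'v set" where
  "trans_closure x = {y. (y, x) \<in> {(u, v). u \<in> elts v}\<^sup>+}"

text \<open>\<open>H(\<kappa>\<^sup>+)\<close>: having cardinality less than \<open>\<kappa>\<^sup>+\<close> is having cardinality at most \<open>\<kappa>\<close>.\<close>

definition H_succ :: "'v::set_universe \<Rightarrow> 'v set" where
  "H_succ \<kappa> = {x. trans_closure x \<lesssim> elts \<kappa>}"


section \<open>\<open>ZFC\<^sup>-\<close>\<close>

datatype fm = Member nat nat | Equal nat nat | Neg fm | Conj fm fm | Forall nat fm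

primrec sat :: "'v::set_universe set \<Rightarrow> (nat \<Rightarrow> 'v) \<Rightarrow> fm \<Rightarrow> bool" where
  "sat M s (Member m n) \<longleftrightarrow> s m \<in> elts (s n)"
| "sat M s (Equal m n) \<longleftrightarrow> s m = s n"
| "sat M s (Neg \<phi>) \<longleftrightarrow> \<not> sat M s \<phi>"
| "sat M s (Conj \<phi> \<psi>) \<longleftrightarrow> sat M s \<phi> \<and> sat M s \<psi>"
| "sat M s (Forall n \<phi>) \<longleftrightarrow> (\<forall>x\<in>M. sat M (s(n := x)) \<phi>)"

text \<open>
  \<open>M\<close> believes that \<open>r\<close> is a strict well-order of \<open>x\<close>, for \<open>x, r \<in> M\<close> and \<open>M\<close> transitive
  (ordered pairs are then absolute, and only the minimality clause depends on \<open>M\<close>).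
\<close>

definition well_order_in :: "'v::set_universe set \<Rightarrow> 'v \<Rightarrow> 'v \<Rightarrow> bool" where
  "well_order_in M x r \<longleftrightarrow>
     (\<forall>u\<in>elts x. vpair u u \<notin> elts r) \<and>
     (\<forall>u\<in>elts x. \<forall>v\<in>elts x. \<forall>w\<in>elts x.
        vpair u v \<in> elts r \<longrightarrow> vpair v w \<in> elts r \<longrightarrow> vpair u w \<in> elts r) \<and>
     (\<forall>u\<in>elts x. \<forall>v\<in>elts x. u = v \<or> vpair u v \<in> elts r \<or> vpair v u \<in> elts r) \<and>
     (\<forall>y\<in>M. elts y \<subseteq> elts x \<and> elts y \<noteq> {} \<longrightarrow>
        (\<exists>m\<in>elts y. \<forall>u\<in>elts y. u = m \<or> vpair m u \<in> elts r))"

text \<open>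
  \<open>(M, \<in>)\<close> satisfies \<open>ZFC\<^sup>-\<close>, that is, ZFC without the power set axiom, for transitive \<open>M\<close>.
  As usual in the absence of power sets, the axioms include the Collection scheme (and not just
  Replacement), and Choice is the statement that every set can be well-ordered.
\<close>

definition ZFC_minus :: "'v::set_universe set \<Rightarrow> bool" where
  "ZFC_minus M \<longleftrightarrow>
     \<comment> \<open>Extensionality\<close>
     (\<forall>x\<in>M. \<forall>y\<in>M. (\<forall>z\<in>M. z \<in> elts x \<longleftrightarrow> z \<in> elts y) \<longrightarrow> x = y) \<and>
     \<comment> \<open>Foundation\<close>
     (\<forall>x\<in>M. (\<exists>y\<in>M. y \<in> elts x) \<longrightarrow>
        (\<exists>y\<in>M. y \<in> elts x \<and> \<not> (\<exists>z\<in>M. z \<in> elts x \<and> z \<in> elts y))) \<and>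
     \<comment> \<open>Pairing\<close>
     (\<forall>x\<in>M. \<forall>y\<in>M. \<exists>z\<in>M. \<forall>w\<in>M. w \<in> elts z \<longleftrightarrow> w = x \<or> w = y) \<and>
     \<comment> \<open>Union\<close>
     (\<forall>x\<in>M. \<exists>u\<in>M. \<forall>z\<in>M. z \<in> elts u \<longleftrightarrow> (\<exists>y\<in>M. y \<in> elts x \<and> z \<in> elts y)) \<and>
     \<comment> \<open>Infinity\<close>
     (\<exists>w\<in>M. (\<exists>e\<in>M. e \<in> elts w \<and> (\<forall>z\<in>M. z \<notin> elts e)) \<and>
        (\<forall>x\<in>M. x \<in> elts w \<longrightarrow>
           (\<exists>y\<in>M. y \<in> elts w \<and> (\<forall>z\<in>M. z \<in> elts y \<longleftrightarrow> z \<in> elts x \<or> z = x)))) \<and>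
     \<comment> \<open>Separation\<close>
     (\<forall>\<phi> s. range s \<subseteq> M \<longrightarrow>
        (\<forall>x\<in>M. \<exists>y\<in>M. \<forall>z\<in>M. z \<in> elts y \<longleftrightarrow> z \<in> elts x \<and> sat M (s(0 := z)) \<phi>)) \<and>
     \<comment> \<open>Collection\<close>
     (\<forall>\<phi> s. range s \<subseteq> M \<longrightarrow>
        (\<forall>a\<in>M. (\<forall>x\<in>M. x \<in> elts a \<longrightarrow> (\<exists>y\<in>M. sat M (s(0 := x, 1 := y)) \<phi>)) \<longrightarrow>
           (\<exists>b\<in>M. \<forall>x\<in>M. x \<in> elts a \<longrightarrow>
              (\<exists>y\<in>M. y \<in> elts b \<and> sat M (s(0 := x, 1 := y)) \<phi>)))) \<and>
     \<comment> \<open>Well-ordering principle\<close>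
     (\<forall>x\<in>M. \<exists>r\<in>M. well_order_in M x r)"


section \<open>Suitable models and ultrafilters\<close>

text \<open>
  The clause \<open>\<kappa> \<in> M\<close> is part of the meaning of ``\<open>M\<close>-ultrafilter on \<open>\<kappa>\<close>'': without it,
  \<open>H(\<kappa>)\<close> could be a suitable model, while \<open>P(\<kappa>) \<inter> H(\<kappa>)\<close> has no greatest element and contains
  no set of cardinality \<open>\<kappa>\<close>.
\<close>

definition suitable :: "'v::set_universe \<Rightarrow> 'v set \<Rightarrow> bool" where
  "suitable \<kappa> M \<longleftrightarrow> M \<subseteq> H_succ \<kappa> \<and> transitive_set M \<and> \<kappa> \<in> M \<and> ZFC_minus M \<and>
     (\<forall>\<alpha>\<in>elts \<kappa>. \<forall>s. s ` elts \<alpha> \<subseteq> M \<longrightarrow> fun_graph \<alpha> s \<in> M)"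

definition Powset :: "'v::set_universe \<Rightarrow> 'v set" where
  "Powset \<kappa> = {x. elts x \<subseteq> elts \<kappa>}"

text \<open>\<open>U\<close> is a proper filter on the family \<open>B\<close> of subsets of \<open>\<kappa>\<close>.\<close>

definition filter_on :: "'v::set_universe \<Rightarrow> 'v set \<Rightarrow> 'v set \<Rightarrow> bool" where
  "filter_on \<kappa> B U \<longleftrightarrow> U \<subseteq> B \<and> \<kappa> \<in> U \<and> (\<forall>x\<in>U. elts x \<noteq> {}) \<and>
     (\<forall>x\<in>U. \<forall>y\<in>B. elts x \<subseteq> elts y \<longrightarrow> y \<in> U) \<and>
     (\<forall>x\<in>U. \<forall>y\<in>U. \<exists>z\<in>U. elts z = elts x \<inter> elts y)"

definition M_ultrafilter :: "'v::set_universe \<Rightarrow> 'v set \<Rightarrow> 'v set \<Rightarrow> bool" where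
  "M_ultrafilter \<kappa> M U \<longleftrightarrow> filter_on \<kappa> (Powset \<kappa> \<inter> M) U \<and>
     (\<forall>x\<in>Powset \<kappa> \<inter> M. x \<in> U \<or> (\<exists>y\<in>U. elts y = elts \<kappa> - elts x))"

definition complete_M_ultrafilter :: "'v::set_universe \<Rightarrow> 'v set \<Rightarrow> 'v set \<Rightarrow> bool" where
  "complete_M_ultrafilter \<kappa> M U \<longleftrightarrow> M_ultrafilter \<kappa> M U \<and>
     (\<forall>X\<subseteq>U. X \<noteq> {} \<and> X \<prec> elts \<kappa> \<longrightarrow> (\<Inter>x\<in>X. elts x) \<noteq> {})"

text \<open>\<open>|A|\<^sup>M \<le> \<kappa>\<close>, that is, \<open>M\<close> contains an injection of \<open>A\<close> into \<open>\<kappa>\<close>.\<close>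

definition card_le_in :: "'v::set_universe \<Rightarrow> 'v set \<Rightarrow> 'v \<Rightarrow> bool" where
  "card_le_in \<kappa> M A \<longleftrightarrow> (\<exists>g. inj_on g (elts A) \<and> g ` elts A \<subseteq> elts \<kappa> \<and> fun_graph A g \<in> M)"

definition amenable :: "'v::set_universe \<Rightarrow> 'v set \<Rightarrow> 'v set \<Rightarrow> bool" where
  "amenable \<kappa> M U \<longleftrightarrow>
     (\<forall>A\<in>M. elts A \<subseteq> Powset \<kappa> \<inter> M \<and> card_le_in \<kappa> M A \<longrightarrow> (\<exists>b\<in>M. elts b = U \<inter> elts A))"

definition complete_filter :: "'v::set_universe \<Rightarrow> 'v set \<Rightarrow> bool" where
  "complete_filter \<kappa> F \<longleftrightarrow> filter_on \<kappa> (Powset \<kappa>) F \<and>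
     (\<forall>X\<subseteq>F. X \<noteq> {} \<and> X \<prec> elts \<kappa> \<longrightarrow> (\<exists>y\<in>F. elts y = (\<Inter>x\<in>X. elts x)))"

definition uniform :: "'v::set_universe \<Rightarrow> 'v set \<Rightarrow> bool" where
  "uniform \<kappa> F \<longleftrightarrow> (\<forall>x\<in>F. elts x \<approx> elts \<kappa>)"


section \<open>Internal approachability and stationarity\<close>

definition internally_approachable :: "'v::set_universe \<Rightarrow> 'v set \<Rightarrow> bool" where
  "internally_approachable \<kappa> M \<longleftrightarrow>
     (\<exists>N. (\<forall>\<alpha>\<in>succ_card \<kappa>. suitable \<kappa> (elts (N \<alpha>))) \<and>
          (\<forall>\<beta>\<in>succ_card \<kappa>. fun_graph \<beta> N \<in> elts (N \<beta>)) \<and>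
          M = (\<Union>\<alpha>\<in>succ_card \<kappa>. elts (N \<alpha>)))"

definition stationarily_many :: "'v::set_universe \<Rightarrow> ('v set \<Rightarrow> bool) \<Rightarrow> bool" where
  "stationarily_many \<kappa> P \<longleftrightarrow>
     (\<forall>F :: 'v set \<Rightarrow> 'v. (\<forall>X. finite X \<and> X \<subseteq> H_succ \<kappa> \<longrightarrow> F X \<in> H_succ \<kappa>) \<longrightarrow>
        (\<exists>M\<subseteq>H_succ \<kappa>. P M \<and> (\<forall>X. finite X \<and> X \<subseteq> M \<longrightarrow> F X \<in> M)))"


section \<open>The game\<close>

text \<open>
  A run \<open>p\<close> assigns to each stage \<open>i < \<kappa>\<^sup>+\<close> the pair \<open>(M\<^sub>i, F\<^sub>i)\<close>; recall that the ordinals \<open>j < i\<close>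
  are the elements of \<open>i\<close>. Values of \<open>p\<close> after the first stage without a legal move are irrelevant.
\<close>

type_synonym 'v run = "'v \<Rightarrow> 'v set \<times> 'v set"

definition I_legal :: "'v::set_universe \<Rightarrow> 'v run \<Rightarrow> 'v \<Rightarrow> 'v set \<Rightarrow> bool" where
  "I_legal \<kappa> p i M \<longleftrightarrow> suitable \<kappa> M \<and> (M \<lesssim> elts \<kappa> \<or> M \<lesssim> elts i) \<and>
     (\<Union>j\<in>elts i. fst (p j)) \<subseteq> M"

definition II_legal :: "'v::set_universe \<Rightarrow> 'v run \<Rightarrow> 'v \<Rightarrow> 'v set \<Rightarrow> bool" where
  "II_legal \<kappa> p i F \<longleftrightarrow> complete_filter \<kappa> F \<and> uniform \<kappa> F \<and>
     (\<Union>j\<in>elts i. snd (p j)) \<subseteq> F \<and>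
     complete_M_ultrafilter \<kappa> (fst (p i)) (F \<inter> fst (p i))"

definition I_wins :: "'v::set_universe \<Rightarrow> 'v run \<Rightarrow> bool" where
  "I_wins \<kappa> p \<longleftrightarrow>
     (\<exists>i\<in>succ_card \<kappa>.
        (\<forall>j\<in>elts i. I_legal \<kappa> p j (fst (p j)) \<and> II_legal \<kappa> p j (snd (p j))) \<and>
        I_legal \<kappa> p i (fst (p i)) \<and> (\<nexists>F. II_legal \<kappa> p i F))"

text \<open>
  A strategy for Player I maps each stage and the history of the play before it to a move. It wins
  if Player I wins every run in which he follows it and Player II moves legally as long as she can.
\<close>

definition winning_strategy_I ::
  "'v::set_universe \<Rightarrow> ('v \<Rightarrow> 'v run \<Rightarrow> 'v set) \<Rightarrow> bool" where
  "winning_strategy_I \<kappa> \<sigma> \<longleftrightarrow>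
     (\<forall>p. (\<forall>i\<in>succ_card \<kappa>. fst (p i) = \<sigma> i (restrict p (elts i))) \<and>
          (\<forall>i\<in>succ_card \<kappa>. (\<exists>F. II_legal \<kappa> p i F) \<longrightarrow> II_legal \<kappa> p i (snd (p i))) \<longrightarrow>
        I_wins \<kappa> p)"

end

theory Submission
  imports Defs
begin

text \<open>
  If Player I follows \<open>\<sigma>\<close> and \<open>U\<close> is a \<open>\<kappa>\<close>-amenable, \<open>\<kappa>\<close>-complete \<open>M\<close>-ultrafilter for an internally
  approachable \<open>M = \<Union>\<^sub>\<alpha> N\<^sub>\<alpha>\<close>, Player II answers each move \<open>M\<^sub>i\<close> with the filter generated by \<open>U \<inter> M\<^sub>i\<close>.
  Her answers before stage \<open>i\<close> depend on \<open>U\<close> only through \<open>U \<inter> N\<^sub>\<alpha>\<close> for some \<open>\<alpha> < \<kappa>\<^sup>+\<close>, which is an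
  element of \<open>M\<close> by amenability; so if \<open>M\<close> is closed under the function that computes \<open>M\<^sub>i\<close> from
  \<open>i\<close> and this trace, then by induction all \<open>M\<^sub>i\<close> are elements of \<open>M\<close>, and Player II never gets stuck.

  Conversely, given \<open>F\<close>, Player I plays elementary submodels of \<open>H(\<kappa>\<^sup>+)\<close> of size \<open>\<kappa>\<close> closed under \<open>F\<close>
  and \<open><\<kappa>\<close>-sequences, each containing the sequence of the previous moves and the traces of the
  previous filters on them. As this does not win, some run lasts \<open>\<kappa>\<^sup>+\<close> stages, and the unions
  of the models and of the traces of the filters are as required.
\<close>

section \<open>The universe and \<open>H(\<kappa>\<^sup>+)\<close>\<close>

instance fm :: countable
  by countable_datatype

lemma mem_induct [case_names step]:
  fixes x :: "'v::set_universe"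
  assumes "\<And>x. (\<And>y. y \<in> elts x \<Longrightarrow> P y) \<Longrightarrow> P x"
  shows "P x"
  by (rule wf_induct_rule[OF foundation]) (use assms in auto)

lemma mem_not_sym:
  fixes x :: "'v::set_universe"
  assumes "x \<in> elts y"
  shows "y \<notin> elts x"
  using wf_not_sym[OF foundation] assms by blast

text \<open>Earlier values are passed as a restriction because strategies receive histories in this
  form; at an ordinal, recursion along membership sees exactly the earlier stages.\<close>

lemma mem_rec:
  fixes G :: "'v::set_universe \<Rightarrow> ('v \<Rightarrow> 'a) \<Rightarrow> 'a"
  shows "\<exists>f. \<forall>i. f i = G i (restrict f (elts i))"
proof -
  let ?R = "{(x, y :: 'v). x \<in> elts y}"
  have "wfrec ?R (\<lambda>f i. G i (restrict f (elts i))) =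
      (\<lambda>i. G i (restrict (wfrec ?R (\<lambda>f i. G i (restrict f (elts i)))) (elts i)))"
  proof (rule wfrec_fixpoint[OF foundation])
    have "restrict f (elts x) = restrict g (elts x)" if "\<forall>z. (z, x) \<in> ?R \<longrightarrow> f z = g z" for f g x
      using that by (intro restrict_ext) auto
    then show "adm_wf ?R (\<lambda>f i. G i (restrict f (elts i)))"
      unfolding adm_wf_def by metis
  qed
  then show ?thesis
    by (intro exI allI) (rule fun_cong)
qed

lemma lepoll_UN:
  assumes "infinite B" "I \<lesssim> B" "\<And>i. i \<in> I \<Longrightarrow> A i \<lesssim> B"
  shows "(\<Union>i\<in>I. A i) \<lesssim> B"
  using card_of_UNION_ordLeq_infinite[of B I A] assms by (simp add: lepoll_def card_of_ordLeq)

lemma trans_closure_eq: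
  fixes x :: "'a::set_universe"
  shows "trans_closure x = elts x \<union> (\<Union>y\<in>elts x. trans_closure y)"
proof -
  let ?R = "{(u, v :: 'a). u \<in> elts v}"
  have "z \<in> trans_closure x \<longleftrightarrow> z \<in> elts x \<or> (\<exists>y\<in>elts x. z \<in> trans_closure y)" for z
  proof
    assume "z \<in> trans_closure x"
    then have "(z, x) \<in> ?R\<^sup>+"
      by (simp add: trans_closure_def)
    then show "z \<in> elts x \<or> (\<exists>y\<in>elts x. z \<in> trans_closure y)"
      by cases (auto simp: trans_closure_def)
  next
    assume "z \<in> elts x \<or> (\<exists>y\<in>elts x. z \<in> trans_closure y)"
    then show "z \<in> trans_closure x"
      unfolding trans_closure_def by (auto intro: trancl_into_trancl)
  qed
  then show ?thesis
    by blast
qed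

lemma Ord_in_Ord: "Ord \<alpha> \<Longrightarrow> \<beta> \<in> elts \<alpha> \<Longrightarrow> Ord \<beta>"
  unfolding Ord_def transitive_set_def by blast

lemma Ord_subset: "Ord \<alpha> \<Longrightarrow> \<beta> \<in> elts \<alpha> \<Longrightarrow> elts \<beta> \<subseteq> elts \<alpha>"
  unfolding Ord_def transitive_set_def by blast

lemma fun_graph_cong: "(\<And>x. x \<in> elts d \<Longrightarrow> f x = g x) \<Longrightarrow> fun_graph d f = fun_graph d g"
  unfolding fun_graph_def by (metis (no_types, lifting) image_cong)

lemma well_order_in_mono: "M \<subseteq> N \<Longrightarrow> well_order_in N x r \<Longrightarrow> well_order_in M x r"
  unfolding well_order_in_def by (elim conjE, intro conjI) (assumption | blast)+

lemma II_legal_cong: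
  assumes "\<And>j. j \<in> elts i \<Longrightarrow> snd (p j) = snd (q j)" "fst (p i) = fst (q i)"
  shows "II_legal \<kappa> p i = II_legal \<kappa> q i"
  unfolding II_legal_def fun_eq_iff using assms by auto

section \<open>Cardinalities at most \<kappa> and below \<kappa>\<close>

locale regular_uncountable =
  fixes \<kappa> :: "'v::set_universe"
  assumes regular: "regular_cardinal \<kappa>" and uncountable: "uncountable (elts \<kappa>)"
begin

abbreviation H :: "'v set" where "H \<equiv> H_succ \<kappa>"
abbreviation small :: "'a set \<Rightarrow> bool" where "small X \<equiv> X \<lesssim> elts \<kappa>"

lemma inf_kappa: "infinite (elts \<kappa>)" and Ord_kappa: "Ord \<kappa>"
  using regular by (auto simp: regular_cardinal_def Card_def)

lemma bounded: "X \<subseteq> elts \<kappa> \<Longrightarrow> X \<prec> elts \<kappa> \<Longrightarrow> \<exists>\<beta>\<in>elts \<kappa>. X \<subseteq> elts \<beta>"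
  using regular by (auto simp: regular_cardinal_def)

lemma elts_lesspoll: "\<alpha> \<in> elts \<kappa> \<Longrightarrow> elts \<alpha> \<prec> elts \<kappa>"
  using regular by (auto simp: regular_cardinal_def Card_def)

lemma small_subset: "small X \<Longrightarrow> Y \<subseteq> X \<Longrightarrow> small Y"
  by (rule lepoll_trans[OF subset_imp_lepoll])

lemma small_image: "small X \<Longrightarrow> small (f ` X)"
  by (rule lepoll_trans[OF image_lepoll])

lemma small_UN: "small I \<Longrightarrow> (\<And>i. i \<in> I \<Longrightarrow> small (A i)) \<Longrightarrow> small (\<Union>i\<in>I. A i)"
  by (rule lepoll_UN[OF inf_kappa])

lemma small_finite: "finite X \<Longrightarrow> small X"
  by (simp add: finite_lepoll_infinite inf_kappa)

lemma small_countable: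
  assumes "countable X"
  shows "small X"
proof -
  have "X \<lesssim> (UNIV :: nat set)"
    using assms by (auto simp: countable_def lepoll_def)
  then show ?thesis
    by (rule lepoll_trans) (use inf_kappa infinite_le_lepoll in blast)
qed

text \<open>The uncountability of \<kappa> enters here: it lets countable sequences of parameters be
  coded by sequences indexed by an ordinal below \<kappa>.\<close>

lemma countable_lesspoll_kappa: "countable X \<Longrightarrow> X \<prec> elts \<kappa>"
  by (metis countable_eqpoll eqpoll_sym lepoll_iff_leqpoll small_countable uncountable)

lemma small_Un: "small X \<Longrightarrow> small Y \<Longrightarrow> small (X \<union> Y)"
  using small_UN[of UNIV "\<lambda>b. if b then X else Y", OF small_finite] by (simp add: UNIV_bool Un_commute)

lemma small_insert: "small X \<Longrightarrow> small (insert x X)"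
  using small_Un[of "{x}" X] by (simp add: small_finite)

lemma lesspoll_insert:
  assumes "X \<prec> elts \<kappa>"
  shows "insert x X \<prec> elts \<kappa>"
proof (cases "finite X")
  case True
  then show ?thesis
    by (simp add: finite_lesspoll_infinite inf_kappa)
next
  case False
  then show ?thesis
    by (rule lesspoll_trans1[OF infinite_insert_lepoll assms])
qed

lemma elts_vset:
  fixes X :: "'v set"
  assumes "small X"
  shows "elts (vset X) = X"
proof -
  obtain x where "elts x = X"
    using replacement[OF assms] by auto
  then show ?thesis
    unfolding vset_def by (metis (mono_tags, lifting) extensionality theI)
qed

lemma elts_vset_finite: "finite X \<Longrightarrow> elts (vset X) = (X :: 'v set)"
  by (simp add: elts_vset small_finite)

lemma vset_elts [simp]: "vset (elts x) = (x :: 'v)"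
  unfolding vset_def by (metis (mono_tags, lifting) extensionality the_equality)

text \<open>A union of at most \<kappa> many transitive closures of size at most \<kappa> is again
  that small. This replaces work with transitive closures by induction on membership.\<close>

lemma H_iff: "x \<in> H \<longleftrightarrow> elts x \<subseteq> H \<and> small (elts x)"
proof
  assume "x \<in> H"
  then show "elts x \<subseteq> H \<and> small (elts x)"
    unfolding H_succ_def using trans_closure_eq[of x] by (auto intro: small_subset)
next
  assume "elts x \<subseteq> H \<and> small (elts x)"
  then have "small (trans_closure x)"
    by (subst trans_closure_eq, intro small_Un small_UN) (auto simp: H_succ_def)
  then show "x \<in> H"
    by (simp add: H_succ_def)
qed

lemma H_elts: "x \<in> H \<Longrightarrow> y \<in> elts x \<Longrightarrow> y \<in> H" and H_small: "x \<in> H \<Longrightarrow> small (elts x)"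
  using H_iff[of x] by auto

lemma vset_in_H: "X \<subseteq> H \<Longrightarrow> small X \<Longrightarrow> vset X \<in> H"
  by (simp add: H_iff[of "vset X"] elts_vset)

lemma kappa_in_H: "\<kappa> \<in> H"
proof -
  have "x \<in> elts \<kappa> \<longrightarrow> x \<in> H" for x
  proof (induction x rule: mem_induct)
    case (step x)
    show ?case
    proof
      assume "x \<in> elts \<kappa>"
      moreover from this have "elts x \<subseteq> elts \<kappa>"
        by (rule Ord_subset[OF Ord_kappa])
      ultimately show "x \<in> H"
        using step H_iff[of x] by (auto intro: subset_imp_lepoll)
    qed
  qed
  then show ?thesis
    using H_iff[of \<kappa>] by auto
qed

section \<open>Pairs and graphs of functions\<close>

lemma elts_vpair: "elts (vpair x y) = {vset {x}, vset {x, y :: 'v}}"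
  by (simp add: vpair_def elts_vset_finite)

lemma vpair_inject [simp]: "vpair x y = vpair x' y' \<longleftrightarrow> x = x' \<and> y = (y' :: 'v)"
proof
  assume "vpair x y = vpair x' y'"
  then have "{vset {x}, vset {x, y}} = {vset {x'}, vset {x', y'}}"
    using elts_vpair by metis
  then have "elts ` {vset {x}, vset {x, y}} = elts ` {vset {x'}, vset {x', y'}}"
    by simp
  then have "{{x}, {x, y}} = {{x'}, {x', y'}}"
    by (simp add: elts_vset_finite)
  then show "x = x' \<and> y = y'"
    by (auto simp: doubleton_eq_iff)
qed simp

lemma vpair_in_H: "x \<in> H \<Longrightarrow> y \<in> H \<Longrightarrow> vpair x y \<in> H"
  unfolding vpair_def by (intro vset_in_H) (auto intro!: vset_in_H small_finite)

lemma elts_fun_graph: "small (elts d) \<Longrightarrow> elts (fun_graph (d :: 'v) f) = (\<lambda>x. vpair x (f x)) ` elts d"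
  by (simp add: fun_graph_def elts_vset small_image)

lemma fun_graph_in_H: "d \<in> H \<Longrightarrow> f ` elts d \<subseteq> H \<Longrightarrow> fun_graph d f \<in> H"
  unfolding fun_graph_def
  by (intro vset_in_H small_image) (auto intro!: vpair_in_H dest: H_elts H_small)

text \<open>The regularity of \<open>\<kappa>\<^sup>+\<close>.\<close>

lemma succ_card_bounded:
  assumes "S \<subseteq> succ_card \<kappa>" "small S"
  shows "\<exists>k\<in>succ_card \<kappa>. S \<subseteq> elts k"
proof -
  \<comment> \<open>The union of the successors of the members of \<open>S\<close>: a transitive
    collection of ordinals of size at most \<kappa>, hence an ordinal.\<close>
  let ?X = "S \<union> (\<Union>i\<in>S. elts i)"
  have sm: "small ?X"
    using assms by (intro small_Un small_UN) (auto simp: succ_card_def)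
  then have *: "elts (vset ?X) = ?X"
    by (rule elts_vset)
  have "Ord (vset ?X)"
    using assms(1) unfolding Ord_def transitive_set_def * succ_card_def by blast
  then have "vset ?X \<in> succ_card \<kappa>"
    using sm * by (simp add: succ_card_def)
  then show ?thesis
    using * by blast
qed

lemma succ_card_elts: "i \<in> succ_card \<kappa> \<Longrightarrow> elts i \<subseteq> succ_card \<kappa>"
  using small_subset[OF _ Ord_subset] by (auto simp: succ_card_def intro: Ord_in_Ord)

lemma succ_card_small: "i \<in> succ_card \<kappa> \<Longrightarrow> small (elts i)"
  by (simp add: succ_card_def)

lemma succ_card_in_H: "i \<in> succ_card \<kappa> \<Longrightarrow> i \<in> H"
proof (induction i rule: mem_induct)
  case (step i)
  then show ?case
    using H_iff[of i] succ_card_elts[of i] succ_card_small[of i] by auto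
qed

lemma succ_card_trans: "i \<in> succ_card \<kappa> \<Longrightarrow> j \<in> elts i \<Longrightarrow> k \<in> elts j \<Longrightarrow> k \<in> elts i"
  using Ord_subset[of i j] by (auto simp: succ_card_def)

text \<open>Stages chosen for the members of \<open>X\<close> are bounded by regularity of
  \<open>\<kappa>\<^sup>+\<close>, and monotonicity moves all of \<open>X\<close> to a bounding
  stage.\<close>

lemma succ_card_Union_cover:
  assumes "X \<subseteq> (\<Union>i\<in>succ_card \<kappa>. A i)" "small X"
    and "\<And>i j. i \<in> succ_card \<kappa> \<Longrightarrow> j \<in> elts i \<Longrightarrow> A j \<subseteq> A i"
  shows "\<exists>k\<in>succ_card \<kappa>. X \<subseteq> A k"
proof -
  obtain f where f: "\<And>x. x \<in> X \<Longrightarrow> f x \<in> succ_card \<kappa> \<and> x \<in> A (f x)"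
    using assms(1) by (metis UN_iff subsetD)
  then obtain k where "k \<in> succ_card \<kappa>" "f ` X \<subseteq> elts k"
    using succ_card_bounded[of "f ` X"] small_image[OF assms(2)] by blast
  then show ?thesis
    using f assms(3) by blast
qed


section \<open>Suitable models and restricted ultrafilters\<close>

lemma suitable_elts: "suitable \<kappa> M \<Longrightarrow> x \<in> M \<Longrightarrow> y \<in> elts x \<Longrightarrow> y \<in> M"
  unfolding suitable_def transitive_set_def by auto

lemma suitable_subset_H: "suitable \<kappa> M \<Longrightarrow> M \<subseteq> H"
  unfolding suitable_def by simp

text \<open>Transitivity of \<open>M\<close> makes the witness of the relativized axiom the actual
  pair; Union and Separation are unpacked in the same way.\<close>

lemma suitable_pair:
  assumes "suitable \<kappa> M" "x \<in> M" "y \<in> M"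
  shows "vset {x, y} \<in> M"
proof -
  have ax: "\<forall>x\<in>M. \<forall>y\<in>M. \<exists>z\<in>M. \<forall>w\<in>M. w \<in> elts z \<longleftrightarrow> w = x \<or> w = y"
    using assms(1) unfolding suitable_def ZFC_minus_def by (elim conjE) assumption
  from bspec[OF bspec[OF ax assms(2)] assms(3)]
  obtain z where z: "z \<in> M" "\<forall>w\<in>M. w \<in> elts z \<longleftrightarrow> w = x \<or> w = y"
    by (rule bexE)
  then have "elts z = {x, y}"
    using suitable_elts[OF assms(1) z(1)] assms(2,3) by auto
  then show ?thesis
    using z(1) vset_elts[of z] by simp
qed

lemma suitable_vpair: "suitable \<kappa> M \<Longrightarrow> x \<in> M \<Longrightarrow> y \<in> M \<Longrightarrow> vpair x y \<in> M"
  unfolding vpair_def using suitable_pair[of M x x] by (simp add: suitable_pair)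

lemma suitable_Union:
  assumes "suitable \<kappa> M" "x \<in> M"
  shows "\<exists>u\<in>M. elts u = (\<Union>y\<in>elts x. elts y)"
proof -
  have ax: "\<forall>x\<in>M. \<exists>u\<in>M. \<forall>z\<in>M. z \<in> elts u \<longleftrightarrow> (\<exists>y\<in>M. y \<in> elts x \<and> z \<in> elts y)"
    using assms(1) unfolding suitable_def ZFC_minus_def by (elim conjE) assumption
  from bspec[OF ax assms(2)]
  obtain u where u: "u \<in> M" "\<forall>z\<in>M. z \<in> elts u \<longleftrightarrow> (\<exists>y\<in>M. y \<in> elts x \<and> z \<in> elts y)"
    by (rule bexE)
  have "z \<in> elts u \<longleftrightarrow> (\<exists>y\<in>elts x. z \<in> elts y)" for z
    using u(2) suitable_elts[OF assms(1)] u(1) assms(2) by blast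
  then show ?thesis
    using u(1) by (intro bexI[of _ u]) auto
qed

lemma suitable_insert:
  assumes "suitable \<kappa> M" "x \<in> M" "y \<in> M"
  shows "\<exists>u\<in>M. elts u = insert y (elts x)"
proof -
  have "vset {vset {y, y}, x} \<in> M"
    using assms by (intro suitable_pair)
  from suitable_Union[OF assms(1) this] show ?thesis
    by (simp add: elts_vset_finite)
qed

lemma suitable_Sep:
  assumes "suitable \<kappa> M" "x \<in> M" "range s \<subseteq> M"
  shows "\<exists>y\<in>M. elts y = {z \<in> elts x. sat M (s(0 := z)) \<phi>}"
proof -
  have ax: "\<forall>\<phi> s. range s \<subseteq> M \<longrightarrow>
        (\<forall>x\<in>M. \<exists>y\<in>M. \<forall>z\<in>M. z \<in> elts y \<longleftrightarrow> z \<in> elts x \<and> sat M (s(0 := z)) \<phi>)"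
    using assms(1) unfolding suitable_def ZFC_minus_def by (elim conjE) assumption
  from bspec[OF mp[OF spec[OF spec[OF ax]] assms(3)] assms(2)]
  obtain y where y: "y \<in> M" "\<forall>z\<in>M. z \<in> elts y \<longleftrightarrow> z \<in> elts x \<and> sat M (s(0 := z)) \<phi>"
    by (rule bexE)
  then have "z \<in> elts y \<longleftrightarrow> z \<in> elts x \<and> sat M (s(0 := z)) \<phi>" for z
    using suitable_elts[OF assms(1)] assms(2) by blast
  then show ?thesis
    using y(1) by (intro bexI[of _ y]) auto
qed

lemma suitable_Int:
  assumes "suitable \<kappa> M" "x \<in> M" "y \<in> M"
  shows "\<exists>z\<in>M. elts z = elts x \<inter> elts y"
  using suitable_Sep[OF assms(1,2), of "\<lambda>_. y" "Member 0 1"] assms(3) by (auto simp: Int_def)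

lemma suitable_Diff:
  assumes "suitable \<kappa> M" "x \<in> M" "y \<in> M"
  shows "\<exists>z\<in>M. elts z = elts x - elts y"
  using suitable_Sep[OF assms(1,2), of "\<lambda>_. y" "Neg (Member 0 1)"] assms(3)
  by (auto simp: set_diff_eq)

lemma suitable_kappa: "suitable \<kappa> M \<Longrightarrow> \<kappa> \<in> M"
  unfolding suitable_def by simp

text \<open>
  Indexing the members of \<open>X\<close> by ordinals below some \<open>\<beta> < \<kappa>\<close> and adding \<open>\<kappa>\<close> to each of them makes
  the members of \<open>X\<close> recognizable among the members of \<open>\<Union>\<Union>G\<close> for the graph \<open>G\<close> of the enumeration.
\<close>

lemma suitable_Inter:
  assumes M: "suitable \<kappa> M" and X: "X \<subseteq> M" "X \<subseteq> Powset \<kappa>" "X \<noteq> {}" "X \<prec> elts \<kappa>"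
  shows "\<exists>y\<in>M. elts y = (\<Inter>x\<in>X. elts x)"
proof -
  obtain f where f: "inj_on f X" "f ` X \<subseteq> elts \<kappa>"
    using lesspoll_imp_lepoll[OF X(4)] by (auto simp: lepoll_def)
  have "f ` X \<prec> elts \<kappa>"
    using f(1) X(4) by simp
  then obtain \<beta> where \<beta>: "\<beta> \<in> elts \<kappa>" "f ` X \<subseteq> elts \<beta>"
    using bounded[OF f(2)] by auto
  obtain x0 where x0: "x0 \<in> X"
    using X(3) by auto
  \<comment> \<open>\<open>x0\<close> is a default at indices that \<open>f\<close> does not use, so
    that \<open>g\<close> maps all of \<beta> onto \<open>X\<close>.\<close>
  define g where "g a = (if a \<in> f ` X then the_inv_into X f a else x0)" for a
  have g: "g ` elts \<beta> = X"
  proof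
    show "g ` elts \<beta> \<subseteq> X"
      using x0 f(1) by (auto simp: g_def the_inv_into_f_f)
    show "X \<subseteq> g ` elts \<beta>"
    proof
      fix x assume "x \<in> X"
      then have "x = g (f x)" "f x \<in> elts \<beta>"
        using f(1) \<beta>(2) by (auto simp: g_def the_inv_into_f_f)
      then show "x \<in> g ` elts \<beta>"
        by (rule image_eqI)
    qed
  qed
  define h where "h x = vset (insert \<kappa> (elts x))" for x
  have h: "h x \<in> M \<and> elts (h x) = insert \<kappa> (elts x)" if x: "x \<in> X" for x
  proof -
    obtain u where "u \<in> M" "elts u = insert \<kappa> (elts x)"
      using suitable_insert[OF M, of x \<kappa>] suitable_kappa[OF M] X(1) x by auto
    moreover from this have "u = h x"
      unfolding h_def using vset_elts[of u] by simp
    ultimately show ?thesis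
      by simp
  qed
  have \<beta>M: "\<beta> \<in> M"
    using suitable_elts[OF M suitable_kappa[OF M] \<beta>(1)] .
  define G where "G = fun_graph \<beta> (h \<circ> g)"
  have "(h \<circ> g) ` elts \<beta> \<subseteq> M"
    using g h by auto
  then have "G \<in> M"
    using M \<beta>(1) unfolding suitable_def G_def by auto
  moreover have Gel: "elts G = (\<lambda>a. vpair a (h (g a))) ` elts \<beta>"
    unfolding G_def using elts_fun_graph[of \<beta>] lesspoll_imp_lepoll[OF elts_lesspoll[OF \<beta>(1)]] by simp
  ultimately obtain G' where "G' \<in> M" "elts G' = (\<Union>p\<in>elts G. elts p)"
    using suitable_Union[OF M] by metis
  then obtain D where D: "D \<in> M" "elts D = (\<Union>q\<in>(\<Union>p\<in>elts G. elts p). elts q)"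
    using suitable_Union[OF M] by metis
  \<comment> \<open>With Kuratowski pairs, two unions turn a graph into its domain together with its
    range.\<close>
  have D_eq: "elts D = elts \<beta> \<union> h ` X"
    unfolding D(2) Gel g[symmetric] by (auto simp: elts_vpair elts_vset_finite)
  \<comment> \<open>Variable 2 stands for \<open>D\<close> and variable 3 for \<kappa>; the formula
    keeps those \<open>z\<close> that lie in every member of \<open>D\<close> containing
    \<kappa>.\<close>
  define s where "s = (\<lambda>n::nat. if n = 2 then D else \<kappa>)"
  have "range s \<subseteq> M"
    using D(1) suitable_kappa[OF M] by (auto simp: s_def)
  from suitable_Sep[OF M suitable_kappa[OF M] this,
      of "Forall 1 (Neg (Conj (Conj (Member 1 2) (Member 3 1)) (Neg (Member 0 1))))"]
  obtain y where y: "y \<in> M"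
    "elts y = {z \<in> elts \<kappa>. \<forall>v\<in>M. \<kappa> \<in> elts v \<longrightarrow> v \<in> elts D \<longrightarrow> z \<in> elts v}"
    by (auto simp: s_def)
  \<comment> \<open>No ordinal below \<beta> contains \<kappa>, so \<kappa> marks exactly the sets
    coming from \<open>X\<close>; and the mark is not itself below \<kappa>, so it leaves the
    intersection unchanged.\<close>
  have no: "\<kappa> \<notin> elts a" if "a \<in> elts \<beta>" for a
    using mem_not_sym[of a \<kappa>] Ord_subset[OF Ord_kappa \<beta>(1)] that by auto
  have ne: "\<kappa> \<noteq> z" if "z \<in> elts \<kappa>" for z
    using mem_not_sym that by metis
  have "{v \<in> M. \<kappa> \<in> elts v \<and> v \<in> elts D} = h ` X"
    unfolding D_eq using no h by auto
  then have "elts y = {z \<in> elts \<kappa>. \<forall>v\<in>h ` X. z \<in> elts v}"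
    unfolding y(2) by (metis (no_types, lifting) mem_Collect_eq)
  also have "\<dots> = {z \<in> elts \<kappa>. \<forall>x\<in>X. z \<in> elts x}"
    using h ne by auto
  also have "\<dots> = (\<Inter>x\<in>X. elts x)"
    using X(2) x0 by (auto simp: Powset_def)
  finally show ?thesis
    using y(1) by auto
qed

text \<open>Upward closure is enough for the intended \<open>A\<close>, the trace of an ultrafilter
  on a suitable model: such a trace is already closed under intersections of fewer than \<kappa>
  members.\<close>

definition generated_filter :: "'v set \<Rightarrow> 'v set" where
  "generated_filter A = {x \<in> Powset \<kappa>. \<exists>y\<in>A. elts y \<subseteq> elts x}"

lemma M_ultrafilter_Compl_notin:
  assumes "M_ultrafilter \<kappa> M U" "x \<in> U" "y \<in> U" "elts y = elts \<kappa> - elts x"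
  shows False
proof -
  obtain z where "z \<in> U" "elts z = elts x \<inter> elts y"
    using assms unfolding M_ultrafilter_def filter_on_def by meson
  then show False
    using assms unfolding M_ultrafilter_def filter_on_def by auto
qed

section \<open>Restricting an ultrafilter to a smaller suitable model\<close>

context
  fixes M U m
  assumes U: "complete_M_ultrafilter \<kappa> M U" and m: "suitable \<kappa> m" "m \<subseteq> M"
begin

lemma U_filter: "U \<subseteq> Powset \<kappa> \<inter> M" "\<kappa> \<in> U" "x \<in> U \<Longrightarrow> elts x \<noteq> {}"
  "x \<in> U \<Longrightarrow> y \<in> Powset \<kappa> \<inter> M \<Longrightarrow> elts x \<subseteq> elts y \<Longrightarrow> y \<in> U"
  using U unfolding complete_M_ultrafilter_def M_ultrafilter_def filter_on_def by auto

lemma U_Compl: "x \<in> Powset \<kappa> \<inter> M \<Longrightarrow> x \<notin> U \<Longrightarrow> \<exists>y\<in>U. elts y = elts \<kappa> - elts x"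
  using U unfolding complete_M_ultrafilter_def M_ultrafilter_def by auto

text \<open>Completeness only promises nonempty intersections. The model \<open>m\<close> contains
  the intersection; were it not in \<open>U\<close>, adjoining its complement would give fewer than
  \<kappa> members of \<open>U\<close> with empty intersection.\<close>

lemma U_Inter:
  assumes X: "X \<subseteq> U \<inter> m" "X \<noteq> {}" "X \<prec> elts \<kappa>"
  shows "\<exists>y\<in>U \<inter> m. elts y = (\<Inter>x\<in>X. elts x)"
proof -
  have XP: "X \<subseteq> Powset \<kappa>"
    using X(1) U_filter(1) by auto
  obtain y where y: "y \<in> m" "elts y = (\<Inter>x\<in>X. elts x)"
    using suitable_Inter[OF m(1) _ XP X(2,3)] X(1) by auto
  have yP: "y \<in> Powset \<kappa> \<inter> M"
    using y XP X(2) m(2) by (auto simp: Powset_def)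
  have "y \<in> U"
  proof (rule ccontr)
    assume "y \<notin> U"
    then obtain c where c: "c \<in> U" "elts c = elts \<kappa> - elts y"
      using U_Compl[OF yP] by auto
    have "insert c X \<subseteq> U" "insert c X \<prec> elts \<kappa>"
      using c(1) X(1) lesspoll_insert[OF X(3)] by auto
    then have "(\<Inter>x\<in>insert c X. elts x) \<noteq> {}"
      using U unfolding complete_M_ultrafilter_def by blast
    then show False
      using c(2) y(2) by auto
  qed
  then show ?thesis
    using y by auto
qed

lemma generated_filter_Int: "generated_filter (U \<inter> m) \<inter> m = U \<inter> m"
  using U_filter(1,4) m(2) unfolding generated_filter_def by blast

lemma generated_filter_complete: "complete_filter \<kappa> (generated_filter (U \<inter> m))"
proof -
  let ?F = "generated_filter (U \<inter> m)"
  have Inter: "\<exists>y\<in>?F. elts y = (\<Inter>x\<in>X. elts x)"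
    if X: "X \<subseteq> ?F" "X \<noteq> {}" "X \<prec> elts \<kappa>" for X
  proof -
    have "\<forall>x\<in>X. \<exists>y. y \<in> U \<inter> m \<and> elts y \<subseteq> elts x"
      using X(1) unfolding generated_filter_def by blast
    then obtain f where f: "\<forall>x\<in>X. f x \<in> U \<inter> m \<and> elts (f x) \<subseteq> elts x"
      using bchoice by metis
    have "f ` X \<subseteq> U \<inter> m" "f ` X \<noteq> {}"
      using f X(2) by auto
    moreover have "f ` X \<prec> elts \<kappa>"
      by (rule lesspoll_trans1[OF image_lepoll X(3)])
    ultimately obtain z where z: "z \<in> U \<inter> m" "elts z = (\<Inter>x\<in>f ` X. elts x)"
      using U_Inter by metis
    have sub: "(\<Inter>x\<in>X. elts x) \<subseteq> elts \<kappa>"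
      using X(1,2) by (auto simp: generated_filter_def Powset_def)
    \<comment> \<open>The intersection may lie outside \<open>M\<close>, but as a subset of \<kappa>
      it is a set of the universe.\<close>
    let ?y = "vset (\<Inter>x\<in>X. elts x)"
    have y: "elts ?y = (\<Inter>x\<in>X. elts x)"
      using sub by (intro elts_vset subset_imp_lepoll)
    have "elts z \<subseteq> elts ?y"
      unfolding z(2) y using f by fastforce
    then have "?y \<in> ?F"
      using sub y z(1) by (auto simp: generated_filter_def Powset_def)
    then show ?thesis
      using y by auto
  qed
  have Int: "\<exists>z\<in>?F. elts z = elts x \<inter> elts y" if "x \<in> ?F" "y \<in> ?F" for x y
    using Inter[of "{x, y}"] that by (simp add: finite_lesspoll_infinite inf_kappa)
  have ne: "elts x \<noteq> {}" if "x \<in> ?F" for x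
    using that U_filter(3) unfolding generated_filter_def by blast
  have "\<kappa> \<in> ?F"
    using U_filter(2) suitable_kappa[OF m(1)] by (auto simp: generated_filter_def Powset_def)
  moreover have "y \<in> ?F" if "x \<in> ?F" "y \<in> Powset \<kappa>" "elts x \<subseteq> elts y" for x y
    using that unfolding generated_filter_def by blast
  moreover have "?F \<subseteq> Powset \<kappa>"
    by (auto simp: generated_filter_def)
  ultimately show ?thesis
    unfolding complete_filter_def filter_on_def using Inter Int ne by (intro conjI ballI allI impI) auto
qed

lemma generated_filter_uniform:
  assumes "uniform \<kappa> U"
  shows "uniform \<kappa> (generated_filter (U \<inter> m))"
  unfolding uniform_def
proof
  fix x assume "x \<in> generated_filter (U \<inter> m)"
  then obtain y where "y \<in> U" "elts y \<subseteq> elts x" "elts x \<subseteq> elts \<kappa>"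
    by (auto simp: generated_filter_def Powset_def)
  then show "elts x \<approx> elts \<kappa>"
    using assms unfolding uniform_def
    by (meson eqpoll_imp_lepoll eqpoll_sym lepoll_antisym lepoll_trans subset_imp_lepoll)
qed

lemma restricted_ultrafilter: "complete_M_ultrafilter \<kappa> m (U \<inter> m)"
proof -
  have "\<exists>z\<in>U \<inter> m. elts z = elts x \<inter> elts y" if "x \<in> U \<inter> m" "y \<in> U \<inter> m" for x y
    using U_Inter[of "{x, y}"] that by (simp add: finite_lesspoll_infinite inf_kappa)
  moreover have "\<exists>y\<in>U \<inter> m. elts y = elts \<kappa> - elts x" if x: "x \<in> Powset \<kappa> \<inter> m" "x \<notin> U" for x
  proof -
    obtain y where y: "y \<in> U" "elts y = elts \<kappa> - elts x"
      using U_Compl x m(2) by blast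
    \<comment> \<open>The complement must also lie in \<open>m\<close>; by extensionality the one
      computed in \<open>m\<close> is the one found in \<open>U\<close>.\<close>
    obtain z where "z \<in> m" "elts z = elts \<kappa> - elts x"
      using suitable_Diff[OF m(1) suitable_kappa[OF m(1)]] x(1) by blast
    then show ?thesis
      using y extensionality by (metis IntI)
  qed
  moreover have "y \<in> U" if "x \<in> U" "y \<in> Powset \<kappa> \<inter> m" "elts x \<subseteq> elts y" for x y
    using U_filter(4) that m(2) by blast
  moreover have "\<kappa> \<in> U \<inter> m" "U \<inter> m \<subseteq> Powset \<kappa> \<inter> m"
    using U_filter(1,2) suitable_kappa[OF m(1)] by auto
  moreover have "(\<Inter>x\<in>X. elts x) \<noteq> {}" if "X \<subseteq> U \<inter> m" "X \<noteq> {} \<and> X \<prec> elts \<kappa>" for X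
    using that U unfolding complete_M_ultrafilter_def by blast
  ultimately show ?thesis
    unfolding complete_M_ultrafilter_def M_ultrafilter_def filter_on_def
    using U_filter(3) by (intro conjI ballI allI impI) auto
qed

end


section \<open>From approachable models to plays of Player II\<close>

text \<open>Closure under a relation reduces to closure under a choice function for it, applied to
  the elements of singletons.\<close>

lemma stationarily_many_closed:
  assumes "stationarily_many \<kappa> P" "\<And>x. x \<in> H \<Longrightarrow> \<exists>y\<in>H. Q x y"
  shows "\<exists>M\<subseteq>H. P M \<and> (\<forall>x\<in>M. \<exists>y\<in>M. Q x y)"
proof -
  obtain f where f: "\<forall>x\<in>H. f x \<in> H \<and> Q x (f x)"
    using bchoice[of H "\<lambda>x y. y \<in> H \<and> Q x y"] assms(2) by fast
  \<comment> \<open>Only the values at singletons of members of \<open>H\<close> matter; \<kappa> is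
    a default in \<open>H\<close>.\<close>
  define F where "F X = (if \<exists>x\<in>H. X = {x} then f (the_elem X) else \<kappa>)" for X
  have "\<forall>X. finite X \<and> X \<subseteq> H \<longrightarrow> F X \<in> H"
    using f kappa_in_H by (auto simp: F_def)
  from mp[OF spec[OF assms(1)[unfolded stationarily_many_def], of F] this]
  obtain M where M: "M \<subseteq> H" "P M" "\<forall>X. finite X \<and> X \<subseteq> M \<longrightarrow> F X \<in> M"
    by (elim exE conjE)
  have "f x \<in> M" if "x \<in> M" for x
  proof -
    have "F {x} \<in> M"
      using M(3) that by simp
    then show ?thesis
      using that M(1) by (auto simp: F_def)
  qed
  then show ?thesis
    using M(1,2) f by (intro exI[of _ M]) auto
qed

text \<open>Player II follows \<open>A\<close> while this is legal and otherwise plays any legal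
  filter, so she moves legally whenever she can. Legality at \<open>i\<close> ignores her own entry
  there, so \<open>{}\<close> is a placeholder.\<close>

definition reply :: "'v set \<Rightarrow> 'v run \<Rightarrow> 'v \<Rightarrow> 'v set \<Rightarrow> 'v set" where
  "reply A h i m =
     (if II_legal \<kappa> (h(i := (m, {}))) i (generated_filter (A \<inter> m)) then generated_filter (A \<inter> m)
      else SOME F. II_legal \<kappa> (h(i := (m, {}))) i F)"

text \<open>\<open>A\<close> is arbitrary so that the run guided by \<open>U\<close> can be compared
  with runs guided by traces of \<open>U\<close> that are elements of the model.\<close>

definition guided_run :: "('v \<Rightarrow> 'v run \<Rightarrow> 'v set) \<Rightarrow> 'v set \<Rightarrow> 'v run" where
  "guided_run \<sigma> A = (SOME p. \<forall>i. p i =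
     (\<sigma> i (restrict p (elts i)),
      reply A (restrict p (elts i)) i (\<sigma> i (restrict p (elts i)))))"

lemma guided_run_eq:
  "guided_run \<sigma> A i =
     (\<sigma> i (restrict (guided_run \<sigma> A) (elts i)),
      reply A (restrict (guided_run \<sigma> A) (elts i)) i (\<sigma> i (restrict (guided_run \<sigma> A) (elts i))))"
proof -
  have "\<exists>p. \<forall>i. p i = (\<sigma> i (restrict p (elts i)),
      reply A (restrict p (elts i)) i (\<sigma> i (restrict p (elts i))))"
    using mem_rec[of "\<lambda>i h. (\<sigma> i h, reply A h i (\<sigma> i h))"] .
  from someI_ex[OF this] show ?thesis
    unfolding guided_run_def by (rule spec)
qed

lemma fst_guided_run: "fst (guided_run \<sigma> A i) = \<sigma> i (restrict (guided_run \<sigma> A) (elts i))"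
  by (subst guided_run_eq) simp

lemma snd_guided_run:
  fixes \<sigma> A
  defines "p \<equiv> guided_run \<sigma> A"
  shows "snd (p i) = (if II_legal \<kappa> p i (generated_filter (A \<inter> fst (p i)))
    then generated_filter (A \<inter> fst (p i)) else SOME F. II_legal \<kappa> p i F)"
proof -
  have i: "i \<notin> elts i"
    using mem_not_sym by blast
  have "II_legal \<kappa> ((restrict p (elts i))(i := (fst (p i), {}))) i = II_legal \<kappa> p i"
    by (rule II_legal_cong) (use i in auto)
  moreover have "snd (p i) = reply A (restrict p (elts i)) i (fst (p i))"
    unfolding p_def fst_guided_run by (subst guided_run_eq) simp
  ultimately show ?thesis
    by (simp add: reply_def)
qed

text \<open>A reply uses \<open>A\<close> only through its trace on the model just played, so by
  induction the two histories agree. Traces at stages before \<open>i\<close> suffice, since the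
  move of Player I at \<open>i\<close> precedes the reply.\<close>

lemma guided_run_cong:
  assumes i: "Ord i" and eq: "\<And>j. j \<in> elts i \<Longrightarrow> A \<inter> fst (guided_run \<sigma> A j) = B \<inter> fst (guided_run \<sigma> A j)"
  shows "fst (guided_run \<sigma> A i) = fst (guided_run \<sigma> B i)"
proof -
  have "j \<in> elts i \<longrightarrow> guided_run \<sigma> A j = guided_run \<sigma> B j" for j
  proof (induction j rule: mem_induct)
    case (step j)
    show ?case
    proof
      assume j: "j \<in> elts i"
      have r: "restrict (guided_run \<sigma> A) (elts j) = restrict (guided_run \<sigma> B) (elts j)"
        using step Ord_subset[OF i j] by (intro restrict_ext) auto
      have "A \<inter> \<sigma> j (restrict (guided_run \<sigma> B) (elts j)) = B \<inter> \<sigma> j (restrict (guided_run \<sigma> B) (elts j))"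
        using eq[OF j] unfolding fst_guided_run r .
      then show "guided_run \<sigma> A j = guided_run \<sigma> B j"
        by (subst (1 2) guided_run_eq) (simp add: r reply_def)
    qed
  qed
  then have "restrict (guided_run \<sigma> A) (elts i) = restrict (guided_run \<sigma> B) (elts i)"
    by (intro restrict_ext) auto
  then show ?thesis
    by (simp add: fst_guided_run)
qed

lemma no_winning_strategy:
  assumes stat: "stationarily_many \<kappa> (\<lambda>M. internally_approachable \<kappa> M \<and> suitable \<kappa> M \<and>
      (\<exists>U. complete_M_ultrafilter \<kappa> M U \<and> uniform \<kappa> U \<and> amenable \<kappa> M U))"
  shows "\<not> winning_strategy_I \<kappa> \<sigma>"
proof
  assume win: "winning_strategy_I \<kappa> \<sigma>"
  \<comment> \<open>The guiding set and the resulting move are coded as elements of the universe, so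
    that a model can be closed under \<open>move\<close>.\<close>
  define move where "move a i = vset (fst (guided_run \<sigma> (elts a) i))" for a i
  \<comment> \<open>The first clause provides the set of subsets of \<kappa> in \<open>x\<close>
    with an injection into \<kappa>, as amenability requires; the second is closure under
    \<open>move\<close>. The witnesses are elements of \<open>y\<close>, so a transitive model
    containing \<open>y\<close> contains them.\<close>
  define Q where "Q x y \<longleftrightarrow>
      (\<exists>A g. elts A = elts x \<inter> Powset \<kappa> \<and> A \<in> elts y \<and> inj_on g (elts A) \<and> g ` elts A \<subseteq> elts \<kappa> \<and>
         fun_graph A g \<in> elts y) \<and>
      (\<forall>i a. x = vpair i a \<longrightarrow> move a i \<in> H \<longrightarrow> move a i \<in> elts y)" for x y
  have "\<exists>y\<in>H. Q x y" if x: "x \<in> H" for x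
  proof -
    define A where "A = vset (elts x \<inter> Powset \<kappa>)"
    have sm: "small (elts x \<inter> Powset \<kappa>)"
      using H_small[OF x] by (rule small_subset) auto
    then have A: "elts A = elts x \<inter> Powset \<kappa>"
      unfolding A_def by (rule elts_vset)
    have AH: "A \<in> H"
      unfolding A_def using H_elts[OF x] sm by (intro vset_in_H) auto
    obtain g where g: "inj_on g (elts A)" "g ` elts A \<subseteq> elts \<kappa>"
      using sm A by (auto simp: lepoll_def)
    have gH: "fun_graph A g \<in> H"
      using g(2) H_elts[OF kappa_in_H] by (intro fun_graph_in_H AH) auto
    define W where "W = {move a i | i a. x = vpair i a \<and> move a i \<in> H}"
    \<comment> \<open>Pairing is injective, so \<open>x\<close> codes at most one pair.\<close>
    have "finite W"
    proof (cases "\<exists>i a. x = vpair i a")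
      case True
      then obtain i a where "x = vpair i a"
        by auto
      then have "W \<subseteq> {move a i}"
        by (auto simp: W_def)
      then show ?thesis
        using finite_subset by blast
    qed (auto simp: W_def)
    moreover have "W \<subseteq> H"
      by (auto simp: W_def)
    ultimately have y: "vset ({A, fun_graph A g} \<union> W) \<in> H"
        "elts (vset ({A, fun_graph A g} \<union> W)) = {A, fun_graph A g} \<union> W"
      using AH gH by (auto intro!: vset_in_H small_finite elts_vset_finite)
    have "Q x (vset ({A, fun_graph A g} \<union> W))"
      unfolding Q_def y(2)
    proof (intro conjI exI[of _ A] exI[of _ g] allI impI)
      fix i a
      assume "x = vpair i a" "move a i \<in> H"
      then have "move a i \<in> W"
        unfolding W_def by blast
      then show "move a i \<in> {A, fun_graph A g} \<union> W"
        by simp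
    qed (use A g in simp_all)
    with y(1) show ?thesis
      by blast
  qed
  from stationarily_many_closed[of _ Q, OF stat this] obtain M U where
    IA: "internally_approachable \<kappa> M" and M: "suitable \<kappa> M" and
    U: "complete_M_ultrafilter \<kappa> M U" "uniform \<kappa> U" "amenable \<kappa> M U" and
    Q: "\<forall>x\<in>M. \<exists>y\<in>M. Q x y"
    by auto
  obtain N where N: "\<And>\<alpha>. \<alpha> \<in> succ_card \<kappa> \<Longrightarrow> suitable \<kappa> (elts (N \<alpha>))"
    "\<And>\<beta>. \<beta> \<in> succ_card \<kappa> \<Longrightarrow> fun_graph \<beta> N \<in> elts (N \<beta>)"
    "M = (\<Union>\<alpha>\<in>succ_card \<kappa>. elts (N \<alpha>))"
    using IA unfolding internally_approachable_def by auto
  \<comment> \<open>The graph of \<open>N\<close> below \<beta> lies in \<open>N \<beta>\<close>;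
    transitivity yields its pairs and then their coordinates.\<close>
  have N_mem: "\<alpha> \<in> elts (N \<beta>) \<and> N \<alpha> \<in> elts (N \<beta>)" if "\<beta> \<in> succ_card \<kappa>" "\<alpha> \<in> elts \<beta>" for \<alpha> \<beta>
  proof -
    note el = suitable_elts[OF N(1)[OF that(1)]]
    have "vpair \<alpha> (N \<alpha>) \<in> elts (N \<beta>)"
      using el[OF N(2)[OF that(1)]] elts_fun_graph[OF succ_card_small[OF that(1)]] that(2) by auto
    from el[OF this, of "vset {\<alpha>, N \<alpha>}"] have "vset {\<alpha>, N \<alpha>} \<in> elts (N \<beta>)"
      by (simp add: elts_vpair)
    from el[OF this] show ?thesis
      by (auto simp: elts_vset_finite)
  qed
  have N_mono: "elts (N \<alpha>) \<subseteq> elts (N \<beta>)" if "\<beta> \<in> succ_card \<kappa>" "\<alpha> \<in> elts \<beta>" for \<alpha> \<beta>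
    using N_mem[OF that] suitable_elts[OF N(1)[OF that(1)]] by auto
  have N_in_M: "\<alpha> \<in> M \<and> N \<alpha> \<in> M" if \<alpha>: "\<alpha> \<in> succ_card \<kappa>" for \<alpha>
  proof -
    obtain \<beta> where "\<beta> \<in> succ_card \<kappa>" "\<alpha> \<in> elts \<beta>"
      using succ_card_bounded[of "{\<alpha>}"] \<alpha> by (auto simp: small_finite)
    then show ?thesis
      using N_mem N(3) by blast
  qed
  \<comment> \<open>Amenability is applied to the set of subsets of \<kappa> in
    \<open>N \<alpha>\<close>. This gives the whole trace, as members of \<open>U\<close> are
    subsets of \<kappa>.\<close>
  have trace: "\<exists>b\<in>M. elts b = U \<inter> elts (N \<alpha>)" if \<alpha>: "\<alpha> \<in> succ_card \<kappa>" for \<alpha>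
  proof -
    obtain y where y: "y \<in> M" and Qy: "Q (N \<alpha>) y"
      using Q N_in_M[OF \<alpha>] by auto
    from Qy obtain A g where Ay: "A \<in> elts y" "fun_graph A g \<in> elts y" and
      A: "elts A = elts (N \<alpha>) \<inter> Powset \<kappa>" "inj_on g (elts A)" "g ` elts A \<subseteq> elts \<kappa>"
      unfolding Q_def by (elim conjE exE)
    have AM: "A \<in> M" "fun_graph A g \<in> M"
      using suitable_elts[OF M y] Ay by auto
    have "elts A \<subseteq> Powset \<kappa> \<inter> M"
      using A(1) N(3) \<alpha> by auto
    moreover have "card_le_in \<kappa> M A"
      unfolding card_le_in_def using A(2,3) AM(2) by (intro exI[of _ g] conjI)
    ultimately obtain b where "b \<in> M" "elts b = U \<inter> elts A"
      using U(3) AM(1) unfolding amenable_def by blast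
    then show ?thesis
      using A(1) U_filter(1)[OF U(1) M subset_refl] by (intro bexI[of _ b]) auto
  qed
  define p where "p = guided_run \<sigma> U"
  have legal: "II_legal \<kappa> p i (snd (p i))" if "\<exists>F. II_legal \<kappa> p i F" for i
    using snd_guided_run[of \<sigma> U i] someI_ex[OF that] unfolding p_def by (auto split: if_splits)
  have "fst (p i) = \<sigma> i (restrict p (elts i))" for i
    unfolding p_def by (rule fst_guided_run)
  then have "I_wins \<kappa> p"
    using win legal unfolding winning_strategy_I_def by blast
  then obtain i where i: "i \<in> succ_card \<kappa>" "\<And>j. j \<in> elts i \<Longrightarrow> I_legal \<kappa> p j (fst (p j))"
    "I_legal \<kappa> p i (fst (p i))" and stuck: "\<nexists>F. II_legal \<kappa> p i F"
    unfolding I_wins_def by auto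
  \<comment> \<open>The stages up to and including the stage \<open>i\<close> at which Player II is
    stuck; Player I moves legally at all of them.\<close>
  define L where "L = insert i (elts i)"
  have L_legal: "I_legal \<kappa> p j (fst (p j))" if "j \<in> L" for j
    using i that by (auto simp: L_def)
  have L_suitable: "suitable \<kappa> (fst (p j))" if "j \<in> L" for j
    using L_legal[OF that] by (simp add: I_legal_def)
  have L_succ: "j \<in> succ_card \<kappa>" if "j \<in> L" for j
    using that i(1) succ_card_elts by (auto simp: L_def)
  have L_elts: "k \<in> L" if "j \<in> L" "k \<in> elts j" for j k
    using that i(1) succ_card_trans by (auto simp: L_def)
  have L_small: "small (fst (p j))" if "j \<in> L" for j
    using L_legal[OF that] succ_card_small[OF L_succ[OF that]] lepoll_trans
    unfolding I_legal_def by blast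
  \<comment> \<open>The at most \<kappa> many earlier models lie in a single
    \<open>N \<alpha>\<close>, so the trace \<open>b\<close> of \<open>U\<close> on it guides the
    same history as \<open>U\<close>. Closure under \<open>move\<close> at \<open>vpair j b\<close>
    puts the next model into \<open>M\<close>.\<close>
  have in_M: "j \<in> L \<longrightarrow> vset (fst (p j)) \<in> M" for j
  proof (induction j rule: mem_induct)
    case (step j)
    show ?case
    proof
      assume j: "j \<in> L"
      let ?S = "(\<lambda>k. vset (fst (p k))) ` elts j"
      have "?S \<subseteq> (\<Union>\<alpha>\<in>succ_card \<kappa>. elts (N \<alpha>))"
        using step L_elts[OF j] N(3) by auto
      moreover have "small ?S"
        using succ_card_small[OF L_succ[OF j]] by (rule small_image)
      ultimately obtain \<alpha> where \<alpha>: "\<alpha> \<in> succ_card \<kappa>" "?S \<subseteq> elts (N \<alpha>)"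
        using succ_card_Union_cover[of ?S "\<lambda>\<alpha>. elts (N \<alpha>)"] N_mono by blast
      obtain b where b: "b \<in> M" "elts b = U \<inter> elts (N \<alpha>)"
        using trace[OF \<alpha>(1)] by auto
      have "U \<inter> fst (p k) = elts b \<inter> fst (p k)" if k: "k \<in> elts j" for k
      proof -
        have "elts (vset (fst (p k))) = fst (p k)"
          using L_small[OF L_elts[OF j k]] by (rule elts_vset)
        then have "fst (p k) \<subseteq> elts (N \<alpha>)"
          using suitable_elts[OF N(1)[OF \<alpha>(1)]] \<alpha>(2) k by blast
        then show ?thesis
          using b(2) by auto
      qed
      then have "fst (p j) = fst (guided_run \<sigma> (elts b) j)"
        unfolding p_def using L_succ[OF j] by (intro guided_run_cong) (auto simp: succ_card_def)
      then have *: "move b j = vset (fst (p j))"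
        by (simp add: move_def)
      have "vset (fst (p j)) \<in> H"
        using suitable_subset_H[OF L_suitable[OF j]] L_small[OF j] by (rule vset_in_H)
      moreover obtain y where "y \<in> M" "Q (vpair j b) y"
        using Q suitable_vpair[OF M _ b(1)] N_in_M[OF L_succ[OF j]] by blast
      ultimately have "vset (fst (p j)) \<in> elts y" "y \<in> M"
        unfolding Q_def *[symmetric] by auto
      then show "vset (fst (p j)) \<in> M"
        using suitable_elts[OF M] by blast
    qed
  qed
  have sub_M: "fst (p j) \<subseteq> M" if "j \<in> L" for j
    using in_M[of j] that suitable_elts[OF M] elts_vset[OF L_small[OF that]] by blast
  \<comment> \<open>By induction each earlier reply was the guided one, so these filters are
    generated by increasing traces of \<open>U\<close> and lie in the next one. At \<open>i\<close>
    this contradicts being stuck.\<close>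
  have II: "j \<in> L \<longrightarrow> II_legal \<kappa> p j (generated_filter (U \<inter> fst (p j)))" for j
  proof (induction j rule: mem_induct)
    case (step j)
    show ?case
    proof
      assume j: "j \<in> L"
      let ?m = "fst (p j)"
      note ctx = U(1) L_suitable[OF j] sub_M[OF j]
      have "snd (p k) \<subseteq> generated_filter (U \<inter> ?m)" if k: "k \<in> elts j" for k
      proof -
        have "snd (p k) = generated_filter (U \<inter> fst (p k))"
          using step[OF k] L_elts[OF j k] snd_guided_run[of \<sigma> U k] unfolding p_def by simp
        moreover have "fst (p k) \<subseteq> ?m"
          using L_legal[OF j] k unfolding I_legal_def by blast
        ultimately show ?thesis
          unfolding generated_filter_def by blast
      qed
      then show "II_legal \<kappa> p j (generated_filter (U \<inter> ?m))"
        unfolding II_legal_def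
        using generated_filter_complete[OF ctx] generated_filter_uniform[OF ctx U(2)]
          restricted_ultrafilter[OF ctx] generated_filter_Int[OF ctx] by auto
    qed
  qed
  show False
    using II[of i] stuck by (simp add: L_def)
qed


section \<open>Elementary submodels of \<open>H(\<kappa>\<^sup>+)\<close>\<close>

text \<open>The well-order comes from choice in the metatheory; its strict part consists of at most
  \<kappa> pairs and so is an element of \<open>H\<close>.\<close>

lemma H_well_order:
  assumes x: "x \<in> H"
  shows "\<exists>r\<in>H. well_order_in H x r"
proof -
  obtain R where R: "well_order_on (elts x) R"
    using well_order_on by blast
  then have lin: "linear_order_on (elts x) R" and wf: "wf (R - Id)"
    by (auto simp: well_order_on_def)
  then have R_props: "trans R" "antisym R" "total_on (elts x) R" "R \<subseteq> elts x \<times> elts x"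
    by (auto simp: linear_order_on_def partial_order_on_def preorder_on_def refl_on_def)
  let ?S = "(\<lambda>(u, v). vpair u v) ` (R - Id)"
  have "elts x \<times> elts x = (\<Union>u\<in>elts x. Pair u ` elts x)"
    by auto
  then have "small (elts x \<times> elts x)"
    by (simp only:) (intro small_UN small_image H_small x)
  then have sm: "small ?S"
    by (intro small_image) (rule small_subset, use R_props(4) in auto)
  have "?S \<subseteq> H"
    using R_props(4) H_elts[OF x] by (auto intro!: vpair_in_H)
  then have "vset ?S \<in> H"
    using sm by (rule vset_in_H)
  moreover have mem: "vpair u v \<in> elts (vset ?S) \<longleftrightarrow> (u, v) \<in> R - Id" for u v
    by (auto simp: elts_vset[OF sm])
  have "well_order_in H x (vset ?S)"
    unfolding well_order_in_def mem
  proof (intro conjI ballI impI)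
    fix u v w assume "(u, v) \<in> R - Id" "(v, w) \<in> R - Id"
    then show "(u, w) \<in> R - Id"
      using R_props(1,2) by (metis Diff_iff IdE IdI antisymD pair_in_Id_conv transD)
  next
    fix u v assume "u \<in> elts x" "v \<in> elts x"
    then show "u = v \<or> (u, v) \<in> R - Id \<or> (v, u) \<in> R - Id"
      using R_props(3) by (auto simp: total_on_def)
  next
    fix y assume y: "elts y \<subseteq> elts x \<and> elts y \<noteq> {}"
    then obtain m where m: "m \<in> elts y" "\<And>u. (u, m) \<in> R - Id \<Longrightarrow> u \<notin> elts y"
      using wf wf_eq_minimal[of "R - Id"] by (metis all_not_in_conv)
    have "u = m \<or> (m, u) \<in> R - Id" if "u \<in> elts y" for u
      using R_props(3) m that y unfolding total_on_def by (metis Diff_iff IdE pair_in_Id_conv subsetD)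
    then show "\<exists>m\<in>elts y. \<forall>u\<in>elts y. u = m \<or> (m, u) \<in> R - Id"
      using m(1) by blast
  qed auto
  ultimately show ?thesis
    by blast
qed

lemma H_infinity:
  "\<exists>w\<in>H. (\<exists>e\<in>elts w. elts e = {}) \<and> (\<forall>x\<in>elts w. \<exists>y\<in>elts w. elts y = insert x (elts x))"
proof -
  \<comment> \<open>\<open>e\<close> enumerates the finite von Neumann ordinals; its range is the
    first infinite ordinal.\<close>
  define e :: "nat \<Rightarrow> 'v" where "e = rec_nat (vset {}) (\<lambda>_ x. vset (insert x (elts x)))"
  have e_Suc: "e (Suc n) = vset (insert (e n) (elts (e n)))" for n
    by (simp add: e_def)
  have e: "e n \<in> H" for n
  proof (induction n)
    case 0
    show ?case
      by (simp add: e_def vset_in_H)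
  next
    case (Suc n)
    then show ?case
      unfolding e_Suc using H_iff[of "e n"] by (intro vset_in_H small_insert) auto
  qed
  have sm: "small (range e)"
    by (rule small_countable) auto
  have "vset (range e) \<in> H"
    using e sm by (intro vset_in_H) auto
  moreover have "elts (e 0) = {}"
    by (simp add: e_def elts_vset)
  moreover have "elts (e (Suc n)) = insert (e n) (elts (e n))" for n
    unfolding e_Suc using H_small[OF e] by (intro elts_vset small_insert)
  ultimately show ?thesis
    by (intro bexI[of _ "vset (range e)"]) (simp_all add: elts_vset[OF sm], blast)
qed

text \<open>
  \<open>S\<close> contains the values at \<open>t\<close> of the operations under which the moves of Player I have to be
  closed; the last clause makes them elementary submodels of \<open>H(\<kappa>\<^sup>+)\<close>. Countable sequences of
  parameters do no harm, as suitable models are closed under them.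
\<close>

definition witnessed :: "('v set \<Rightarrow> 'v) \<Rightarrow> (nat \<Rightarrow> 'v) \<Rightarrow> 'v set \<Rightarrow> bool" where
  "witnessed F t S \<longleftrightarrow>
     elts (t 0) \<subseteq> S \<and> \<kappa> \<in> S \<and> F {} \<in> S \<and> (finite (range t) \<longrightarrow> F (range t) \<in> S) \<and>
     (\<exists>y\<in>S. elts y = {t 0, t 1}) \<and>
     (\<exists>y\<in>S. elts y = (\<Union>x\<in>elts (t 0). elts x)) \<and>
     (\<exists>w\<in>S. (\<exists>e\<in>elts w. elts e = {}) \<and> (\<forall>x\<in>elts w. \<exists>y\<in>elts w. elts y = insert x (elts x))) \<and>
     (\<exists>r\<in>S. well_order_in H (t 0) r) \<and>
     (\<forall>\<phi>. \<exists>y\<in>S. elts y = {z \<in> elts (t 0). sat H ((t \<circ> Suc)(0 := z)) \<phi>}) \<and>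
     (\<forall>\<phi>. \<exists>b\<in>S. \<forall>x\<in>elts (t 0). (\<exists>y\<in>H. sat H ((t \<circ> Suc)(0 := x, 1 := y)) \<phi>) \<longrightarrow>
        (\<exists>y\<in>elts b. sat H ((t \<circ> Suc)(0 := x, 1 := y)) \<phi>)) \<and>
     (\<forall>\<phi> n. (\<exists>y\<in>H. sat H (t(n := y)) \<phi>) \<longrightarrow> (\<exists>y\<in>S. sat H (t(n := y)) \<phi>))"

text \<open>Every clause uses \<open>S\<close> positively.\<close>

lemma witnessed_mono:
  assumes S: "S \<subseteq> S'" and w: "witnessed F t S"
  shows "witnessed F t S'"
proof -
  have bex: "Bex S' P" if "Bex S P" for P
    using S that by blast
  show ?thesis
    using w unfolding witnessed_def
    by (elim conj_forward all_forward imp_forward)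
      (assumption | erule bex | erule subset_trans[OF _ S] | erule subsetD[OF S])+
qed

text \<open>Beyond the at most \<kappa> elements of \<open>t 0\<close>, the clauses need finitely
  many sets and one for each formula or each formula and variable, hence countably many.\<close>

lemma witnessed_exists:
  assumes F: "\<And>X. finite X \<Longrightarrow> X \<subseteq> H \<Longrightarrow> F X \<in> H" and t: "range t \<subseteq> H"
  shows "\<exists>S\<subseteq>H. small S \<and> witnessed F t S"
proof -
  have tH: "t n \<in> H" for n
    using t by auto
  have t0: "elts (t 0) \<subseteq> H" "small (elts (t 0))"
    using tH[of 0] H_iff[of "t 0"] by auto
  define pr where "pr = vset {t 0, t 1}"
  have pr: "pr \<in> H" "elts pr = {t 0, t 1}"
    unfolding pr_def using tH by (auto intro!: vset_in_H small_finite simp: elts_vset_finite)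
  define un where "un = vset (\<Union>x\<in>elts (t 0). elts x)"
  have "small (\<Union>x\<in>elts (t 0). elts x)"
    using t0 by (intro small_UN) (auto intro: H_small)
  moreover have "(\<Union>x\<in>elts (t 0). elts x) \<subseteq> H"
    using t0(1) H_elts by blast
  ultimately have un: "un \<in> H" "elts un = (\<Union>x\<in>elts (t 0). elts x)"
    unfolding un_def by (auto intro: vset_in_H simp: elts_vset)
  obtain w where w: "w \<in> H" "(\<exists>e\<in>elts w. elts e = {}) \<and> (\<forall>x\<in>elts w. \<exists>y\<in>elts w. elts y = insert x (elts x))"
    using H_infinity by (rule bexE)
  obtain r where r: "r \<in> H" "well_order_in H (t 0) r"
    using H_well_order[OF tH] by (rule bexE)
  define sp where "sp \<phi> = vset {z \<in> elts (t 0). sat H ((t \<circ> Suc)(0 := z)) \<phi>}" for \<phi>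
  have sp: "sp \<phi> \<in> H \<and> elts (sp \<phi>) = {z \<in> elts (t 0). sat H ((t \<circ> Suc)(0 := z)) \<phi>}" for \<phi>
  proof -
    have "small {z \<in> elts (t 0). sat H ((t \<circ> Suc)(0 := z)) \<phi>}"
      using t0(2) by (rule small_subset) auto
    then show ?thesis
      unfolding sp_def using t0(1) by (auto intro!: vset_in_H simp: elts_vset)
  qed
  \<comment> \<open>A Skolem function for Collection, with an arbitrary value in \<open>H\<close>
    where no witness exists; \<open>co\<close> below collects its values on
    \<open>t 0\<close>.\<close>
  define cw where "cw \<phi> x = (SOME y. y \<in> H \<and> ((\<exists>y\<in>H. sat H ((t \<circ> Suc)(0 := x, 1 := y)) \<phi>) \<longrightarrow>
    sat H ((t \<circ> Suc)(0 := x, 1 := y)) \<phi>))" for \<phi> x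
  have cw: "cw \<phi> x \<in> H \<and> ((\<exists>y\<in>H. sat H ((t \<circ> Suc)(0 := x, 1 := y)) \<phi>) \<longrightarrow>
    sat H ((t \<circ> Suc)(0 := x, 1 := cw \<phi> x)) \<phi>)" for \<phi> x
    unfolding cw_def by (rule someI_ex) (use kappa_in_H in blast)
  define co where "co \<phi> = vset (cw \<phi> ` elts (t 0))" for \<phi>
  have co: "co \<phi> \<in> H \<and> elts (co \<phi>) = cw \<phi> ` elts (t 0)" for \<phi>
    unfolding co_def using t0(2) cw by (auto intro!: vset_in_H small_image simp: elts_vset small_image)
  \<comment> \<open>Witnesses for the Tarski--Vaught test with parameters from
    \<open>t\<close>.\<close>
  define sk where "sk = (\<lambda>(\<phi>, n). (SOME y. y \<in> H \<and> ((\<exists>y\<in>H. sat H (t(n := y)) \<phi>) \<longrightarrow> sat H (t(n := y)) \<phi>)))"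
  have sk: "sk (\<phi>, n) \<in> H \<and> ((\<exists>y\<in>H. sat H (t(n := y)) \<phi>) \<longrightarrow> sat H (t(n := sk (\<phi>, n))) \<phi>)" for \<phi> n
    unfolding sk_def prod.case by (rule someI_ex) (use kappa_in_H in blast)
  define f where "f = (if finite (range t) then F (range t) else \<kappa>)"
  let ?S = "elts (t 0) \<union> ({\<kappa>, F {}, f, pr, un, w, r} \<union> (range sp \<union> (range co \<union> range sk)))"
  have "?S \<subseteq> H"
    using t0(1) kappa_in_H F[of "{}"] F[of "range t"] t pr(1) un(1) w(1) r(1) sp co sk
    by (auto simp: f_def)
  moreover have "small ?S"
    using t0(2) by (intro small_Un small_countable[of "range _"]) (auto intro: small_finite)
  moreover have "witnessed F t ?S"
    unfolding witnessed_def
  proof (intro conjI allI impI)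
    show "finite (range t) \<Longrightarrow> F (range t) \<in> ?S"
      by (simp add: f_def)
    show "\<exists>y\<in>?S. elts y = {t 0, t 1}"
      by (rule bexI[of _ pr]) (use pr in auto)
    show "\<exists>y\<in>?S. elts y = (\<Union>x\<in>elts (t 0). elts x)"
      by (rule bexI[of _ un]) (use un in auto)
    show "\<exists>w\<in>?S. (\<exists>e\<in>elts w. elts e = {}) \<and> (\<forall>x\<in>elts w. \<exists>y\<in>elts w. elts y = insert x (elts x))"
      using w(2) by (rule bexI[of _ w]) simp
    show "\<exists>r\<in>?S. well_order_in H (t 0) r"
      using r(2) by (rule bexI[of _ r]) simp
    fix \<phi>
    show "\<exists>y\<in>?S. elts y = {z \<in> elts (t 0). sat H ((t \<circ> Suc)(0 := z)) \<phi>}"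
      using conjunct2[OF sp] by (rule bexI[of _ "sp \<phi>"]) simp
    show "\<exists>b\<in>?S. \<forall>x\<in>elts (t 0). (\<exists>y\<in>H. sat H ((t \<circ> Suc)(0 := x, 1 := y)) \<phi>) \<longrightarrow>
        (\<exists>y\<in>elts b. sat H ((t \<circ> Suc)(0 := x, 1 := y)) \<phi>)"
    proof (rule bexI[of _ "co \<phi>"], intro ballI impI)
      fix x assume x: "x \<in> elts (t 0)" "\<exists>y\<in>H. sat H ((t \<circ> Suc)(0 := x, 1 := y)) \<phi>"
      show "\<exists>y\<in>elts (co \<phi>). sat H ((t \<circ> Suc)(0 := x, 1 := y)) \<phi>"
        using mp[OF conjunct2[OF cw] x(2)] by (rule bexI[of _ "cw \<phi> x"]) (use co x(1) in simp)
    qed simp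
    fix n assume "\<exists>y\<in>H. sat H (t(n := y)) \<phi>"
    from mp[OF conjunct2[OF sk] this] show "\<exists>y\<in>?S. sat H (t(n := y)) \<phi>"
      by (rule bexI[of _ "sk (\<phi>, n)"]) simp
  qed (rule Un_upper1, simp_all)
  ultimately show ?thesis
    by blast
qed

text \<open>Closure refers to infinite sequences \<open>t\<close> because assignments in
  \<open>sat\<close> are infinite; nonemptiness of \<open>M\<close> provides at least one.\<close>

definition good :: "('v set \<Rightarrow> 'v) \<Rightarrow> 'v set \<Rightarrow> bool" where
  "good F M \<longleftrightarrow> M \<subseteq> H \<and> M \<noteq> {} \<and> (\<forall>t. range t \<subseteq> M \<longrightarrow> witnessed F t M) \<and>
     (\<forall>\<alpha>\<in>elts \<kappa>. \<forall>s. s ` elts \<alpha> \<subseteq> M \<longrightarrow> fun_graph \<alpha> s \<in> M)"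

lemma goodD: "good F M \<Longrightarrow> range t \<subseteq> M \<Longrightarrow> witnessed F t M"
  unfolding good_def by blast

text \<open>The Tarski--Vaught test, whose hypothesis is the last clause of \<open>witnessed\<close>.\<close>

lemma good_sat:
  assumes "good F M"
  shows "range s \<subseteq> M \<Longrightarrow> sat M s \<phi> \<longleftrightarrow> sat H s \<phi>"
proof (induction \<phi> arbitrary: s)
  case (Forall n \<phi>)
  have M: "M \<subseteq> H"
    using assms by (simp add: good_def)
  have IH: "sat M (s(n := x)) \<phi> \<longleftrightarrow> sat H (s(n := x)) \<phi>" if "x \<in> M" for x
    using Forall.prems that by (intro Forall.IH) auto
  \<comment> \<open>The universal quantifier is primitive, so the test is applied to the negation: a
    counterexample in \<open>H\<close> yields one in \<open>M\<close>.\<close>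
  have "(\<exists>y\<in>H. sat H (s(n := y)) (Neg \<phi>)) \<longrightarrow> (\<exists>y\<in>M. sat H (s(n := y)) (Neg \<phi>))"
    using goodD[OF assms Forall.prems] unfolding witnessed_def by blast
  then show ?case
    using IH M by auto
qed auto

text \<open>A nonempty finite set is the range of a sequence; the empty set is not, and has its own
  clause in \<open>witnessed\<close>.\<close>

lemma good_closed:
  assumes M: "good F M" and X: "finite X" "X \<subseteq> M"
  shows "F X \<in> M"
proof (cases "X = {}")
  case True
  obtain x where "x \<in> M"
    using M by (auto simp: good_def)
  then have "witnessed F (\<lambda>_. x) M"
    by (intro goodD[OF M]) auto
  then show ?thesis
    using True by (simp add: witnessed_def)
next
  case False
  then have "range (from_nat_into X) = X"
    using X(1) by (simp add: uncountable_infinite countable_finite)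
  then show ?thesis
    using goodD[OF M, of "from_nat_into X"] X by (simp add: witnessed_def)
qed

text \<open>By elementarity, the sets that \<open>witnessed\<close> describes through
  \<open>sat H\<close> verify Separation and Collection in \<open>M\<close>.\<close>

lemma good_suitable:
  assumes M: "good F M"
  shows "suitable \<kappa> M"
proof -
  have MH: "M \<subseteq> H"
    using M by (simp add: good_def)
  \<comment> \<open>One sequence \<open>t\<close> carries both arguments: \<open>t 0\<close> is the
    set \<open>x\<close>, and \<open>t \<circ> Suc\<close> is the assignment
    \<open>s\<close>.\<close>
  have w: "witnessed F (case_nat x s) M" if "x \<in> M" "range s \<subseteq> M" for x s
    using that by (intro goodD[OF M]) (auto simp: image_subset_iff split: nat.splits)
  have w1: "witnessed F (case_nat x (\<lambda>_. y)) M" if "x \<in> M" "y \<in> M" for x y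
    using that by (intro w) auto
  have el: "y \<in> M" if "x \<in> M" "y \<in> elts x" for x y
    using w1[OF that(1,1)] that(2) by (auto simp: witnessed_def)
  obtain x0 where x0: "x0 \<in> M"
    using M by (auto simp: good_def)
  have kM: "\<kappa> \<in> M"
    using w1[OF x0 x0] by (simp add: witnessed_def)
  have shift: "case_nat x s \<circ> Suc = s" for x and s :: "nat \<Rightarrow> 'v"
    by auto
  have "ZFC_minus M"
    unfolding ZFC_minus_def
  proof (intro conjI ballI allI impI)
    fix x y assume "x \<in> M" "y \<in> M" "\<forall>z\<in>M. z \<in> elts x \<longleftrightarrow> z \<in> elts y"
    then show "x = y"
      using el by (intro extensionality) blast
  next
    fix x assume x: "x \<in> M" "\<exists>y\<in>M. y \<in> elts x"
    then obtain y where "y \<in> elts x" "\<And>z. z \<in> elts y \<Longrightarrow> z \<notin> elts x"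
      using wfE_min[OF foundation, of _ "elts x"] by (metis (no_types, lifting) case_prodI mem_Collect_eq)
    then show "\<exists>y\<in>M. y \<in> elts x \<and> \<not> (\<exists>z\<in>M. z \<in> elts x \<and> z \<in> elts y)"
      using el[OF x(1)] by blast
  next
    fix x y assume "x \<in> M" "y \<in> M"
    then have "\<exists>z\<in>M. elts z = {x, y}"
      using w1 by (simp add: witnessed_def)
    then show "\<exists>z\<in>M. \<forall>w\<in>M. w \<in> elts z \<longleftrightarrow> w = x \<or> w = y"
      by auto
  next
    fix x assume x: "x \<in> M"
    then have "\<exists>u\<in>M. elts u = (\<Union>y\<in>elts x. elts y)"
      using w1[OF x x] by (simp add: witnessed_def)
    then show "\<exists>u\<in>M. \<forall>z\<in>M. z \<in> elts u \<longleftrightarrow> (\<exists>y\<in>M. y \<in> elts x \<and> z \<in> elts y)"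
      using el[OF x] by (metis UN_iff)
  next
    have "\<exists>w\<in>M. (\<exists>e\<in>elts w. elts e = {}) \<and> (\<forall>x\<in>elts w. \<exists>y\<in>elts w. elts y = insert x (elts x))"
      using w1[OF x0 x0] unfolding witnessed_def by (elim conjE) assumption
    then obtain w where w: "w \<in> M" "\<exists>e\<in>elts w. elts e = {}"
      "\<forall>x\<in>elts w. \<exists>y\<in>elts w. elts y = insert x (elts x)"
      by auto
    have "\<exists>e\<in>M. e \<in> elts w \<and> (\<forall>z\<in>M. z \<notin> elts e)"
      using w(2) el[OF w(1)] by auto
    moreover have "\<exists>y\<in>M. y \<in> elts w \<and> (\<forall>z\<in>M. z \<in> elts y \<longleftrightarrow> z \<in> elts x \<or> z = x)" if x: "x \<in> elts w" for x
    proof -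
      obtain y where "y \<in> elts w" "elts y = insert x (elts x)"
        using w(3) x by auto
      then show ?thesis
        using el[OF w(1)] by (intro bexI[of _ y]) auto
    qed
    ultimately show "\<exists>w\<in>M. (\<exists>e\<in>M. e \<in> elts w \<and> (\<forall>z\<in>M. z \<notin> elts e)) \<and>
        (\<forall>x\<in>M. x \<in> elts w \<longrightarrow>
           (\<exists>y\<in>M. y \<in> elts w \<and> (\<forall>z\<in>M. z \<in> elts y \<longleftrightarrow> z \<in> elts x \<or> z = x)))"
      using w(1) by blast
  next
    fix \<phi> and s :: "nat \<Rightarrow> 'v" and x assume s: "range s \<subseteq> M" and x: "x \<in> M"
    have "\<exists>y\<in>M. elts y = {z \<in> elts x. sat H (s(0 := z)) \<phi>}"
      using w[OF x s] unfolding witnessed_def shift by (elim conjE allE[of _ \<phi>]) simp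
    moreover have "sat M (s(0 := z)) \<phi> \<longleftrightarrow> sat H (s(0 := z)) \<phi>" if "z \<in> M" for z
      using s that by (intro good_sat[OF M]) auto
    ultimately show "\<exists>y\<in>M. \<forall>z\<in>M. z \<in> elts y \<longleftrightarrow> z \<in> elts x \<and> sat M (s(0 := z)) \<phi>"
      by auto
  next
    fix \<phi> and s :: "nat \<Rightarrow> 'v" and a assume s: "range s \<subseteq> M" and a: "a \<in> M"
      and ex: "\<forall>x\<in>M. x \<in> elts a \<longrightarrow> (\<exists>y\<in>M. sat M (s(0 := x, 1 := y)) \<phi>)"
    have abs: "sat M (s(0 := x, 1 := y)) \<phi> \<longleftrightarrow> sat H (s(0 := x, 1 := y)) \<phi>" if "x \<in> M" "y \<in> M" for x y
      using s that by (intro good_sat[OF M]) auto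
    have "\<exists>b\<in>M. \<forall>x\<in>elts a. (\<exists>y\<in>H. sat H (s(0 := x, 1 := y)) \<phi>) \<longrightarrow>
        (\<exists>y\<in>elts b. sat H (s(0 := x, 1 := y)) \<phi>)"
      using w[OF a s] unfolding witnessed_def shift by (elim conjE allE[of _ \<phi>]) simp
    then obtain b where b: "b \<in> M" "\<forall>x\<in>elts a. (\<exists>y\<in>H. sat H (s(0 := x, 1 := y)) \<phi>) \<longrightarrow>
        (\<exists>y\<in>elts b. sat H (s(0 := x, 1 := y)) \<phi>)"
      by (rule bexE)
    have "\<exists>y\<in>M. y \<in> elts b \<and> sat M (s(0 := x, 1 := y)) \<phi>" if x: "x \<in> M" "x \<in> elts a" for x
    proof -
      obtain y where "y \<in> M" "sat M (s(0 := x, 1 := y)) \<phi>"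
        using ex x by auto
      then have "\<exists>y\<in>H. sat H (s(0 := x, 1 := y)) \<phi>"
        using MH abs[OF x(1)] by auto
      then obtain z where "z \<in> elts b" "sat H (s(0 := x, 1 := z)) \<phi>"
        using b(2) x(2) by auto
      then show ?thesis
        using abs[OF x(1)] el[OF b(1)] by auto
    qed
    then show "\<exists>b\<in>M. \<forall>x\<in>M. x \<in> elts a \<longrightarrow> (\<exists>y\<in>M. y \<in> elts b \<and> sat M (s(0 := x, 1 := y)) \<phi>)"
      using b(1) by auto
  next
    fix x assume x: "x \<in> M"
    then have "\<exists>r\<in>M. well_order_in H x r"
      using w1[OF x x] by (simp add: witnessed_def)
    then show "\<exists>r\<in>M. well_order_in M x r"
      using well_order_in_mono[OF MH] by auto
  qed
  then show ?thesis
    using M kM el unfolding suitable_def good_def transitive_set_def by auto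
qed

text \<open>The closure conditions concern sequences of at most \<kappa> elements, and each such
  sequence lies in a single stage.\<close>

lemma good_Union:
  assumes "\<And>i. i \<in> succ_card \<kappa> \<Longrightarrow> good F (A i)"
    and "\<And>i j. i \<in> succ_card \<kappa> \<Longrightarrow> j \<in> elts i \<Longrightarrow> A j \<subseteq> A i"
  shows "good F (\<Union>i\<in>succ_card \<kappa>. A i)"
  unfolding good_def
proof (intro conjI allI impI ballI)
  show "(\<Union>i\<in>succ_card \<kappa>. A i) \<subseteq> H"
    using assms(1) unfolding good_def by blast
  obtain i where "i \<in> succ_card \<kappa>"
    using succ_card_bounded[of "{}"] by auto
  then show "(\<Union>i\<in>succ_card \<kappa>. A i) \<noteq> {}"
    using assms(1)[of i] by (auto simp: good_def)
next
  fix t :: "nat \<Rightarrow> 'v" assume "range t \<subseteq> (\<Union>i\<in>succ_card \<kappa>. A i)"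
  moreover have "small (range t)"
    by (rule small_countable) auto
  ultimately obtain k where k: "k \<in> succ_card \<kappa>" "range t \<subseteq> A k"
    using succ_card_Union_cover[of _ A] assms(2) by metis
  then have "witnessed F t (A k)"
    using goodD[OF assms(1)] by blast
  then show "witnessed F t (\<Union>i\<in>succ_card \<kappa>. A i)"
    by (rule witnessed_mono[rotated]) (use k(1) in auto)
next
  fix \<alpha> s assume \<alpha>: "\<alpha> \<in> elts \<kappa>" and "s ` elts \<alpha> \<subseteq> (\<Union>i\<in>succ_card \<kappa>. A i)"
  moreover have "small (s ` elts \<alpha>)"
    using small_image lesspoll_imp_lepoll[OF elts_lesspoll[OF \<alpha>]] by blast
  ultimately obtain k where k: "k \<in> succ_card \<kappa>" "s ` elts \<alpha> \<subseteq> A k"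
    using succ_card_Union_cover[of _ A] assms(2) by metis
  then show "fun_graph \<alpha> s \<in> (\<Union>i\<in>succ_card \<kappa>. A i)"
    using assms(1)[OF k(1)] \<alpha> unfolding good_def by blast
qed

text \<open>The hull is built in \<kappa> steps, each adding the values of \<Psi> at all sequences
  of length below \<kappa> from the earlier ones. The hypothesis \<open>card\<close>, that is
  \<open>\<kappa>^(<\<kappa>) = \<kappa>\<close>, keeps each step small; by regularity of \<kappa>,
  each such sequence from the union comes from the levels below some \<beta>.\<close>

lemma hull_exists:
  assumes card: "(SIGMA \<alpha>:elts \<kappa>. elts \<alpha> \<rightarrow>\<^sub>E elts \<kappa>) \<approx> elts \<kappa>"
    and \<Psi>: "\<And>\<alpha> s. \<alpha> \<in> elts \<kappa> \<Longrightarrow> s \<in> elts \<alpha> \<rightarrow>\<^sub>E H \<Longrightarrow> \<Psi> \<alpha> s \<subseteq> H \<and> small (\<Psi> \<alpha> s)"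
    and B: "B \<subseteq> H" "small B"
  shows "\<exists>M\<subseteq>H. B \<subseteq> M \<and> small M \<and> (\<forall>\<alpha>\<in>elts \<kappa>. \<forall>s\<in>elts \<alpha> \<rightarrow>\<^sub>E M. \<Psi> \<alpha> s \<subseteq> M)"
proof -
  define I where "I Y = (SIGMA \<alpha>:elts \<kappa>. elts \<alpha> \<rightarrow>\<^sub>E Y)" for Y :: "'v set"
  define step where "step Y = Y \<union> (\<Union>q\<in>I Y. \<Psi> (fst q) (snd q))" for Y
  obtain L :: "'v \<Rightarrow> 'v set" where L0: "\<And>i. L i = step (B \<union> (\<Union>j\<in>elts i. restrict L (elts i) j))"
    using mem_rec[of "\<lambda>i f. step (B \<union> (\<Union>j\<in>elts i. f j))"] by blast
  define below where "below i = B \<union> (\<Union>j\<in>elts i. L j)" for i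
  have L: "L i = step (below i)" for i
    unfolding below_def by (subst L0) simp
  have step_bound: "step Y \<subseteq> H \<and> small (step Y)" if Y: "Y \<subseteq> H" "small Y" for Y
  proof -
    have "I Y \<lesssim> I (elts \<kappa>)"
      unfolding I_def using Y(2) by (intro Sigma_lepoll_mono lepoll_funcset_right order_refl)
    then have sm: "small (I Y)"
      using card unfolding I_def by (rule lepoll_trans2)
    have "\<Psi> (fst q) (snd q) \<subseteq> H \<and> small (\<Psi> (fst q) (snd q))" if "q \<in> I Y" for q
      using that Y(1) by (intro \<Psi>) (auto simp: I_def PiE_iff)
    then show ?thesis
      unfolding step_def using Y sm by (intro conjI small_Un small_UN) auto
  qed
  have L_bound: "i \<in> elts \<kappa> \<longrightarrow> L i \<subseteq> H \<and> small (L i)" for i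
  proof (induction i rule: mem_induct)
    case (step i)
    show ?case
    proof
      assume i: "i \<in> elts \<kappa>"
      then have *: "L j \<subseteq> H \<and> small (L j)" if "j \<in> elts i" for j
        using step that Ord_subset[OF Ord_kappa i] by auto
      have "small (elts i)"
        using elts_lesspoll[OF i] by (rule lesspoll_imp_lepoll)
      then have "small (below i)"
        unfolding below_def using * B(2) by (intro small_Un small_UN) auto
      moreover have "below i \<subseteq> H"
        unfolding below_def using * B(1) by auto
      ultimately show "L i \<subseteq> H \<and> small (L i)"
        unfolding L[of i] by (intro step_bound)
    qed
  qed
  define M where "M = (\<Union>i\<in>elts \<kappa>. L i)"
  have "M \<subseteq> H" "small M"
    unfolding M_def using L_bound by (auto intro!: small_UN)
  moreover have "B \<subseteq> M"
  proof -
    have "elts \<kappa> \<noteq> {}"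
      using inf_kappa by auto
    then obtain i where "i \<in> elts \<kappa>"
      by auto
    moreover have "B \<subseteq> L i"
      unfolding L[of i] step_def below_def by auto
    ultimately show ?thesis
      unfolding M_def by auto
  qed
  moreover have "\<Psi> \<alpha> s \<subseteq> M" if \<alpha>: "\<alpha> \<in> elts \<kappa>" and s: "s \<in> elts \<alpha> \<rightarrow>\<^sub>E M" for \<alpha> s
  proof -
    have "\<forall>x\<in>elts \<alpha>. \<exists>i. i \<in> elts \<kappa> \<and> s x \<in> L i"
      using s unfolding M_def by (auto simp: PiE_iff)
    then obtain b where b: "\<forall>x\<in>elts \<alpha>. b x \<in> elts \<kappa> \<and> s x \<in> L (b x)"
      using bchoice by metis
    have "b ` elts \<alpha> \<prec> elts \<kappa>"
      by (rule lesspoll_trans1[OF image_lepoll elts_lesspoll[OF \<alpha>]])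
    moreover have "b ` elts \<alpha> \<subseteq> elts \<kappa>"
      using b by auto
    ultimately obtain \<beta> where \<beta>: "\<beta> \<in> elts \<kappa>" "b ` elts \<alpha> \<subseteq> elts \<beta>"
      using bounded by metis
    have "s \<in> elts \<alpha> \<rightarrow>\<^sub>E below \<beta>"
      using s b \<beta>(2) unfolding below_def PiE_iff by auto
    then have "(\<alpha>, s) \<in> I (below \<beta>)"
      using \<alpha> by (simp add: I_def)
    then have "\<Psi> \<alpha> s \<subseteq> L \<beta>"
      unfolding L[of \<beta>] step_def by force
    then show ?thesis
      using \<beta>(1) unfolding M_def by auto
  qed
  ultimately show ?thesis
    by (intro exI[of _ M] conjI ballI)
qed

lemma good_extension:
  assumes card: "(SIGMA \<alpha>:elts \<kappa>. elts \<alpha> \<rightarrow>\<^sub>E elts \<kappa>) \<approx> elts \<kappa>"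
    and F: "\<And>X. finite X \<Longrightarrow> X \<subseteq> H \<Longrightarrow> F X \<in> H"
    and B: "B \<subseteq> H" "small B"
  shows "\<exists>M. B \<subseteq> M \<and> small M \<and> good F M"
proof -
  have "\<exists>S. range t \<subseteq> H \<longrightarrow> S \<subseteq> H \<and> small S \<and> witnessed F t S" for t
    using witnessed_exists[of F t, OF F] by blast
  then obtain W where W: "\<And>t. range t \<subseteq> H \<Longrightarrow> W t \<subseteq> H \<and> small (W t) \<and> witnessed F t (W t)"
    by metis
  \<comment> \<open>\<open>e0\<close> places the natural numbers below \<kappa>, and \<omega> is any
    ordinal below \<kappa> that contains its range; a countable sequence is then read off a sequence
    of length \<omega>.\<close>
  obtain e0 :: "nat \<Rightarrow> 'v" where e0: "inj e0" "range e0 \<subseteq> elts \<kappa>"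
    using inf_kappa unfolding infinite_iff_countable_subset by auto
  have "range e0 \<prec> elts \<kappa>"
    by (rule countable_lesspoll_kappa) auto
  then obtain \<omega> where \<omega>: "\<omega> \<in> elts \<kappa>" "range e0 \<subseteq> elts \<omega>"
    using bounded[OF e0(2)] by auto
  \<comment> \<open>One operation serves both closures: the graph of \<open>s\<close> for short
    sequences, and \<open>W\<close> for the countable sequence coded by \<open>s\<close>.\<close>
  define \<Psi> where "\<Psi> \<alpha> s = insert (fun_graph \<alpha> s) (if range (s \<circ> e0) \<subseteq> H then W (s \<circ> e0) else {})" for \<alpha> s
  have "\<Psi> \<alpha> s \<subseteq> H \<and> small (\<Psi> \<alpha> s)" if "\<alpha> \<in> elts \<kappa>" "s \<in> elts \<alpha> \<rightarrow>\<^sub>E H" for \<alpha> s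
  proof -
    have "fun_graph \<alpha> s \<in> H"
      using that H_elts[OF kappa_in_H] by (intro fun_graph_in_H) auto
    then show ?thesis
      unfolding \<Psi>_def using W[of "s \<circ> e0"] by (auto intro!: small_insert)
  qed
  moreover have "insert \<kappa> B \<subseteq> H" "small (insert \<kappa> B)"
    using B kappa_in_H small_insert by auto
  ultimately have "\<exists>M\<subseteq>H. insert \<kappa> B \<subseteq> M \<and> small M \<and> (\<forall>\<alpha>\<in>elts \<kappa>. \<forall>s\<in>elts \<alpha> \<rightarrow>\<^sub>E M. \<Psi> \<alpha> s \<subseteq> M)"
    by (intro hull_exists[OF card])
  then obtain M where M: "M \<subseteq> H" "insert \<kappa> B \<subseteq> M" "small M"
    and "\<forall>\<alpha>\<in>elts \<kappa>. \<forall>s\<in>elts \<alpha> \<rightarrow>\<^sub>E M. \<Psi> \<alpha> s \<subseteq> M"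
    by (elim exE conjE)
  then have closed: "\<Psi> \<alpha> s \<subseteq> M" if "\<alpha> \<in> elts \<kappa>" "s \<in> elts \<alpha> \<rightarrow>\<^sub>E M" for \<alpha> s
    using that by auto
  have graph: "fun_graph \<alpha> s \<in> M" if "\<alpha> \<in> elts \<kappa>" "s ` elts \<alpha> \<subseteq> M" for \<alpha> s
  proof -
    have "restrict s (elts \<alpha>) \<in> elts \<alpha> \<rightarrow>\<^sub>E M"
      using that(2) by auto
    from closed[OF that(1) this] have "fun_graph \<alpha> (restrict s (elts \<alpha>)) \<in> M"
      by (simp add: \<Psi>_def)
    then show ?thesis
      using fun_graph_cong[of \<alpha> "restrict s (elts \<alpha>)" s] by simp
  qed
  have "witnessed F t M" if t: "range t \<subseteq> M" for t
  proof -
    \<comment> \<open>Off the range of \<open>e0\<close> the value of \<open>inv e0\<close> is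
      arbitrary, but \<open>t\<close> still maps it into \<open>M\<close>.\<close>
    define s where "s = restrict (t \<circ> inv e0) (elts \<omega>)"
    have s: "s \<in> elts \<omega> \<rightarrow>\<^sub>E M"
      unfolding s_def using t by auto
    have st: "s \<circ> e0 = t"
      unfolding s_def using \<omega>(2) e0(1) by (auto simp: fun_eq_iff)
    have "range t \<subseteq> H"
      using t M(1) by auto
    then have "W t \<subseteq> M"
      using closed[OF \<omega>(1) s] st by (simp add: \<Psi>_def)
    then show ?thesis
      using W[OF \<open>range t \<subseteq> H\<close>] witnessed_mono by blast
  qed
  then have "good F M"
    unfolding good_def using M(1,2) graph by blast
  then show ?thesis
    using M(2,3) by blast
qed


section \<open>From plays of Player II to approachable models\<close>

lemma stationarily_many_approachable:
  assumes card: "(SIGMA \<alpha>:elts \<kappa>. elts \<alpha> \<rightarrow>\<^sub>E elts \<kappa>) \<approx> elts \<kappa>"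
    and no_win: "\<nexists>\<sigma>. winning_strategy_I \<kappa> \<sigma>"
  shows "stationarily_many \<kappa> (\<lambda>M. internally_approachable \<kappa> M \<and> suitable \<kappa> M \<and>
      (\<exists>U. complete_M_ultrafilter \<kappa> M U \<and> uniform \<kappa> U \<and> amenable \<kappa> M U))"
  unfolding stationarily_many_def
proof (intro allI impI)
  fix F :: "'v set \<Rightarrow> 'v"
  assume "\<forall>X. finite X \<and> X \<subseteq> H \<longrightarrow> F X \<in> H"
  then have F: "\<And>X. finite X \<Longrightarrow> X \<subseteq> H \<Longrightarrow> F X \<in> H"
    by blast
  \<comment> \<open>The three ingredients, models, graph and traces, make the moves increasing, the
    union internally approachable and the resulting ultrafilter amenable.\<close>
  define base where "base h i = (\<Union>j\<in>elts i. fst (h j)) \<union>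
      insert (fun_graph i (\<lambda>j. vset (fst (h j)))) ((\<lambda>j. vset (fst (h j) \<inter> snd (h j))) ` elts i)"
    for h :: "'v run" and i
  define \<sigma> where "\<sigma> i h = (SOME M. base h i \<subseteq> M \<and> small M \<and> good F M)" for i h
  have base_restrict: "base (restrict h (elts i)) i = base h i" for h i
    unfolding base_def
    using fun_graph_cong[of i "\<lambda>j. vset (fst (restrict h (elts i) j))" "\<lambda>j. vset (fst (h j))"] by simp
  have "\<not> winning_strategy_I \<kappa> \<sigma>"
    using no_win by simp
  then obtain p where "\<forall>i\<in>succ_card \<kappa>. fst (p i) = \<sigma> i (restrict p (elts i))"
    "\<forall>i\<in>succ_card \<kappa>. (\<exists>F. II_legal \<kappa> p i F) \<longrightarrow> II_legal \<kappa> p i (snd (p i))"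
    and not_wins: "\<not> I_wins \<kappa> p"
    unfolding winning_strategy_I_def by auto
  then have p: "fst (p i) = \<sigma> i (restrict p (elts i))"
    "\<exists>F. II_legal \<kappa> p i F \<Longrightarrow> II_legal \<kappa> p i (snd (p i))" if "i \<in> succ_card \<kappa>" for i
    using that by simp_all
  define m where "m i = fst (p i)" for i
  define f where "f i = snd (p i)" for i
  \<comment> \<open>\<open>base\<close> is small, so a good extension gives Player I a legal move;
    as he does not win the run, Player II then has one too, and the run lasts through all
    stages.\<close>
  have stage: "i \<in> succ_card \<kappa> \<longrightarrow> I_legal \<kappa> p i (m i) \<and> II_legal \<kappa> p i (f i) \<and>
      base p i \<subseteq> m i \<and> small (m i) \<and> good F (m i)" for i
  proof (induction i rule: mem_induct)
    case (step i)
    show ?case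
    proof
      assume i: "i \<in> succ_card \<kappa>"
      then have IH: "I_legal \<kappa> p j (m j)" "II_legal \<kappa> p j (f j)" "small (m j)" "m j \<subseteq> H"
        if "j \<in> elts i" for j
        using step[OF that] succ_card_elts[OF i] that by (auto simp: good_def)
      have vm: "vset (m j) \<in> H" "vset (m j \<inter> f j) \<in> H" if "j \<in> elts i" for j
        using IH(3,4)[OF that] by (auto intro!: vset_in_H elim: small_subset)
      have "base p i \<subseteq> H"
        unfolding base_def m_def[symmetric] f_def[symmetric]
        using vm IH(4) succ_card_in_H[OF i] by (auto intro!: fun_graph_in_H)
      moreover have "small (base p i)"
        unfolding base_def m_def[symmetric] f_def[symmetric]
        using IH(3) succ_card_small[OF i] by (intro small_Un small_UN small_insert small_image)
      ultimately have "\<exists>M. base p i \<subseteq> M \<and> small M \<and> good F M"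
        by (intro good_extension[OF card F])
      from someI_ex[OF this] have g: "base p i \<subseteq> m i" "small (m i)" "good F (m i)"
        unfolding m_def p(1)[OF i] \<sigma>_def base_restrict by auto
      then have I: "I_legal \<kappa> p i (m i)"
        unfolding I_legal_def using good_suitable by (auto simp: base_def)
      then have "\<exists>F. II_legal \<kappa> p i F"
        using not_wins i IH(1,2) unfolding I_wins_def m_def f_def by blast
      then have "II_legal \<kappa> p i (f i)"
        unfolding f_def by (rule p(2)[OF i])
      then show "I_legal \<kappa> p i (m i) \<and> II_legal \<kappa> p i (f i) \<and>
          base p i \<subseteq> m i \<and> small (m i) \<and> good F (m i)"
        using g I by simp
    qed
  qed
  have m: "base p i \<subseteq> m i" "small (m i)" "good F (m i)" "suitable \<kappa> (m i)" if "i \<in> succ_card \<kappa>" for i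
    using stage[of i] that good_suitable by auto
  have II: "II_legal \<kappa> p i (f i)" if "i \<in> succ_card \<kappa>" for i
    using stage[of i] that by simp
  have m_mono: "m j \<subseteq> m i" if "i \<in> succ_card \<kappa>" "j \<in> elts i" for i j
    using m(1)[OF that(1)] that(2) by (auto simp: base_def m_def)
  have f_mono: "f j \<subseteq> f i" if "i \<in> succ_card \<kappa>" "j \<in> elts i" for i j
    using II[OF that(1)] that(2) by (auto simp: II_legal_def f_def)
  have f_ultra: "complete_M_ultrafilter \<kappa> (m i) (f i \<inter> m i)" if "i \<in> succ_card \<kappa>" for i
    using II[OF that] by (simp add: II_legal_def m_def)
  have f_ultra': "M_ultrafilter \<kappa> (m i) (f i \<inter> m i)" if "i \<in> succ_card \<kappa>" for i
    using f_ultra[OF that] by (simp add: complete_M_ultrafilter_def)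
  define M where "M = (\<Union>i\<in>succ_card \<kappa>. m i)"
  define U where "U = (\<Union>i\<in>succ_card \<kappa>. f i \<inter> m i)"
  have cover: "\<exists>k\<in>succ_card \<kappa>. X \<subseteq> m k" if "X \<subseteq> M" "small X" for X
    using succ_card_Union_cover[of X m] that m_mono unfolding M_def by blast
  \<comment> \<open>Later filters do not change decisions: were the complement of \<open>x\<close>
    in \<open>f i\<close>, both would lie in \<open>f k\<close> at a common later stage
    \<open>k\<close>.\<close>
  have U_m: "U \<inter> m i = f i \<inter> m i" if i: "i \<in> succ_card \<kappa>" for i
  proof
    show "f i \<inter> m i \<subseteq> U \<inter> m i"
      using i by (auto simp: U_def)
    show "U \<inter> m i \<subseteq> f i \<inter> m i"
    proof
      fix x assume x: "x \<in> U \<inter> m i"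
      then obtain j where j: "j \<in> succ_card \<kappa>" "x \<in> f j" "x \<in> m j"
        by (auto simp: U_def)
      obtain k where k: "k \<in> succ_card \<kappa>" "i \<in> elts k" "j \<in> elts k"
        using succ_card_bounded[of "{i, j}"] i j(1) by (auto simp: small_finite)
      have "x \<in> Powset \<kappa> \<inter> m i"
        using x j f_ultra'[OF j(1)] unfolding M_ultrafilter_def filter_on_def by blast
      moreover have False if c: "c \<in> f i \<inter> m i" "elts c = elts \<kappa> - elts x" for c
      proof (rule M_ultrafilter_Compl_notin[OF f_ultra'[OF k(1)] _ _ c(2)])
        show "x \<in> f k \<inter> m k" "c \<in> f k \<inter> m k"
          using j c(1) f_mono[OF k(1)] m_mono[OF k(1)] k by auto
      qed
      ultimately show "x \<in> f i \<inter> m i"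
        using f_ultra'[OF i] unfolding M_ultrafilter_def by blast
    qed
  qed
  have small_cover: "\<exists>k\<in>succ_card \<kappa>. {x, y} \<subseteq> m k" if "x \<in> M" "y \<in> M" for x y
    using cover[of "{x, y}"] that by (simp add: small_finite)
  have UM: "U \<subseteq> M"
    by (auto simp: U_def M_def)
  have Uk: "filter_on \<kappa> (Powset \<kappa> \<inter> m k) (U \<inter> m k)" if "k \<in> succ_card \<kappa>" for k
    using f_ultra'[OF that] U_m[OF that] by (simp add: M_ultrafilter_def)
  have "filter_on \<kappa> (Powset \<kappa> \<inter> M) U"
    unfolding filter_on_def
  proof (intro conjI ballI impI)
    show "U \<subseteq> Powset \<kappa> \<inter> M"
      using f_ultra' unfolding M_ultrafilter_def filter_on_def U_def M_def by fast
    obtain i where i: "i \<in> succ_card \<kappa>"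
      using succ_card_bounded[of "{}"] by auto
    show "\<kappa> \<in> U"
      using Uk[OF i] by (auto simp: filter_on_def)
    fix x assume x: "x \<in> U"
    then obtain k where k: "k \<in> succ_card \<kappa>" "x \<in> m k"
      using small_cover[of x x] UM by auto
    show "elts x \<noteq> {}"
      using Uk[OF k(1)] x k(2) by (auto simp: filter_on_def)
    {
      fix y assume y: "y \<in> Powset \<kappa> \<inter> M" "elts x \<subseteq> elts y"
      obtain k where "k \<in> succ_card \<kappa>" "{x, y} \<subseteq> m k"
        using small_cover[of x y] UM x y by auto
      then show "y \<in> U"
        using Uk[of k] x y unfolding filter_on_def by blast
    next
      fix y assume y: "y \<in> U"
      obtain k where "k \<in> succ_card \<kappa>" "{x, y} \<subseteq> m k"
        using small_cover[of x y] UM x y by auto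
      then show "\<exists>z\<in>U. elts z = elts x \<inter> elts y"
        using Uk[of k] x y unfolding filter_on_def by blast
    }
  qed
  moreover have "x \<in> U \<or> (\<exists>y\<in>U. elts y = elts \<kappa> - elts x)"
    if x: "x \<in> Powset \<kappa> \<inter> M" for x
  proof -
    obtain k where k: "k \<in> succ_card \<kappa>" "x \<in> m k"
      using small_cover[of x x] x by auto
    then show ?thesis
      using f_ultra'[OF k(1)] x unfolding M_ultrafilter_def U_m[OF k(1), symmetric] by blast
  qed
  moreover have "(\<Inter>x\<in>X. elts x) \<noteq> {}" if X: "X \<subseteq> U" "X \<noteq> {} \<and> X \<prec> elts \<kappa>" for X
  proof -
    \<comment> \<open>Fewer than \<kappa> members of \<open>U\<close> lie in one model of the chain,
      so completeness at that stage applies.\<close>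
    obtain k where k: "k \<in> succ_card \<kappa>" "X \<subseteq> m k"
      using cover[of X] X UM lesspoll_imp_lepoll by blast
    then have "X \<subseteq> f k \<inter> m k"
      using X(1) U_m[OF k(1)] by blast
    then show ?thesis
      using f_ultra[OF k(1)] X(2) unfolding complete_M_ultrafilter_def by blast
  qed
  ultimately have ultra: "complete_M_ultrafilter \<kappa> M U"
    by (simp add: complete_M_ultrafilter_def M_ultrafilter_def)
  have "uniform \<kappa> U"
    using II unfolding II_legal_def uniform_def U_def by blast
  have good: "good F M"
    unfolding M_def using m(3) m_mono by (rule good_Union)
  have M_suitable: "suitable \<kappa> M"
    by (rule good_suitable[OF good])
  have "amenable \<kappa> M U"
    unfolding amenable_def
  proof (intro ballI impI)
    fix A assume A: "A \<in> M" "elts A \<subseteq> Powset \<kappa> \<inter> M \<and> card_le_in \<kappa> M A"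
    obtain k where k: "k \<in> succ_card \<kappa>" "A \<in> m k"
      using small_cover[of A A] A(1) by auto
    \<comment> \<open>The trace of \<open>f k\<close> on \<open>m k\<close> is an element of the
      model at the later stage \<open>l\<close>, and it determines \<open>U\<close> on
      \<open>A\<close>, since \<open>A\<close> is a subset of \<open>m k\<close>.\<close>
    obtain l where l: "l \<in> succ_card \<kappa>" "k \<in> elts l"
      using succ_card_bounded[of "{k}"] k(1) by (auto simp: small_finite)
    have "vset (m k \<inter> f k) \<in> M"
      using m(1)[OF l(1)] l by (auto simp: base_def m_def f_def M_def)
    moreover have "elts (vset (m k \<inter> f k)) = m k \<inter> f k"
      using m(2)[OF k(1)] by (intro elts_vset) (auto elim: small_subset)
    ultimately obtain b where "b \<in> M" "elts b = elts A \<inter> (m k \<inter> f k)"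
      using suitable_Int[OF M_suitable A(1)] by metis
    moreover have "elts A \<subseteq> m k"
      using suitable_elts[OF m(4)[OF k(1)] k(2)] by auto
    ultimately show "\<exists>b\<in>M. elts b = U \<inter> elts A"
      using U_m[OF k(1)] by (intro bexI[of _ b]) auto
  qed
  moreover have "internally_approachable \<kappa> M"
    unfolding internally_approachable_def
  proof (intro exI[of _ "\<lambda>i. vset (m i)"] conjI ballI)
    have elts_m: "elts (vset (m i)) = m i" if "i \<in> succ_card \<kappa>" for i
      by (rule elts_vset[OF m(2)[OF that]])
    show "suitable \<kappa> (elts (vset (m i)))" if "i \<in> succ_card \<kappa>" for i
      using m(4)[OF that] elts_m[OF that] by simp
    show "fun_graph i (\<lambda>i. vset (m i)) \<in> elts (vset (m i))" if "i \<in> succ_card \<kappa>" for i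
      using m(1)[OF that] elts_m[OF that] by (simp add: base_def m_def)
    show "M = (\<Union>i\<in>succ_card \<kappa>. elts (vset (m i)))"
      unfolding M_def using elts_m by auto
  qed
  moreover have "M \<subseteq> H" "\<forall>X. finite X \<and> X \<subseteq> M \<longrightarrow> F X \<in> M"
    using good good_closed[OF good] by (auto simp: good_def)
  ultimately show "\<exists>M\<subseteq>H. (internally_approachable \<kappa> M \<and> suitable \<kappa> M \<and>
      (\<exists>U. complete_M_ultrafilter \<kappa> M U \<and> uniform \<kappa> U \<and> amenable \<kappa> M U)) \<and>
      (\<forall>X. finite X \<and> X \<subseteq> M \<longrightarrow> F X \<in> M)"
    using ultra \<open>uniform \<kappa> U\<close> M_suitable by blast
qed

end

text \<open>The last assumption is \<open>\<kappa>^(<\<kappa>) = \<kappa>\<close>, which provides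
  suitable models of size \<kappa>. Uniformity of \<open>U\<close> excludes principal ultrafilters,
  which are complete and amenable for every suitable model.\<close>

theorem theorem3p21:
  fixes \<kappa> :: "'v::set_universe"
  assumes "regular_cardinal \<kappa>" and "uncountable (elts \<kappa>)"
    and "(SIGMA \<alpha>:elts \<kappa>. elts \<alpha> \<rightarrow>\<^sub>E elts \<kappa>) \<approx> elts \<kappa>"
  shows "(\<nexists>\<sigma>. winning_strategy_I \<kappa> \<sigma>) \<longleftrightarrow>
    stationarily_many \<kappa> (\<lambda>M. internally_approachable \<kappa> M \<and> suitable \<kappa> M \<and>
      (\<exists>U. complete_M_ultrafilter \<kappa> M U \<and> uniform \<kappa> U \<and> amenable \<kappa> M U))"
proof -
  interpret regular_uncountable \<kappa>
    using assms(1,2) by unfold_locales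
  show ?thesis
    using no_winning_strategy stationarily_many_approachable[OF assms(3)] by blast
qed

end
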